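(* Let $p$ be a prime, let $(G,+)$ be a horizontal pro-$p$ abelian group of bounded exponent and let $R\subset\mathcal{O}_{\mathbb{C}_p}$ be a complete subring with discrete $p$-adic valuation. Let $\nu\in R\llbracket G\rrbracket$ be a $p$-adic measure satisfying $\nu(\mathbf{1})\neq 0$. Then there exists a finite subgroup of characters $M_\nu\leq\widehat{G}$ such that the following holds: for any character $\chi\in\widehat{G}$ there exists $\chi_0\in M_\nu$ such that for all $n\in\mathbb{Z}$ $$\nu((\chi\chi_0)^n)\neq 0.$$
   Context: An abelian profinite group $G$ is horizontal pro-$p$ if it is isomorphic to an infinite product $\prod_{n\in\mathbb{N}}\mathbb{Z}/p^{m_n}$ with all $m_n\geq 1$ (with the product topology). Its exponent is $e(G):=\sup_{g\in G}\log_p(|g|)$, where $|g|$ is the order of $g$ and $\log_p$ is the base-$p$ logarithm; $G$ has bounded exponent if $e(G)<\infty$, i.e. if the sequence $(m_n)$ is bounded. $\mathbb{C}_p$ is the completion of an algebraic closure of $\mathbb{Q}_p$ with norm $|\cdot|_p$ and valuation ring $\mathcal{O}_{\mathbb{C}_p}=\{|x|_p\leq 1\}$. For a $p$-adically complete subring $R\subset\mathcal{O}_{\mathbb{C}_p}$, the Iwasawa algebra is $R\llbracket G\rrbracket:=\varprojlim_{H\leq G\text{ open}}R[G/H]$, identified with the $R$-algebra (under convolution) $\mathrm{Hom}_{\mathrm{cts}}(\mathcal{C}(G,R),R)$ of $R$-valued measures on $G$, where $\mathcal{C}(G,R)$ is the module of continuous functions $G\to R$ with the sup-norm topology. Via $R\llbracket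 G\rrbracket\subset\mathcal{O}_{\mathbb{C}_p}\llbracket G\rrbracket$ one can evaluate $\nu(\varphi)\in\mathcal{O}_{\mathbb{C}_p}$ for any continuous $\varphi:G\to\mathcal{O}_{\mathbb{C}_p}$. $\widehat{G}$ is the group of continuous characters $G\to\mathcal{O}_{\mathbb{C}_p}^\times$, and $\mathbf{1}$ is the trivial character. *)

theory Defs
  imports
    "HOL-Algebra.Algebraic_Closure_Type"
    "HOL-Algebra.Elementary_Groups"
    "HOL-Algebra.Product_Groups"
    "HOL-Algebra.Multiplicative_Group"
    "HOL-Analysis.Analysis"
begin

section \<open>The field of p-adic complex numbers\<close>

text \<open>
  The p-adic complex numbers are given as a field type \<open>'a\<close> together with its absolute value
  \<open>N\<close>; subsets of \<open>'a\<close> always carry the metric and the topology induced by \<open>N\<close>.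
\<close>

definition nmetric :: "('a::field_char_0 \<Rightarrow> real) \<Rightarrow> 'a set \<Rightarrow> 'a metric" where
  "nmetric N A = metric (A, \<lambda>x y. N (x - y))"

text \<open>
  \<open>(UNIV, N)\<close> is a completion of an algebraic closure of the p-adic numbers.  In a complete
  non-archimedean field with \<open>|p| = 1/p\<close> the closure of the rationals is the field of p-adic
  numbers with its standard absolute value, and the absolute value of an algebraic extension of
  it is unique, so the axioms determine \<open>(UNIV, N)\<close> up to isometric isomorphism.
\<close>

locale padic_complex_field =
  fixes p :: nat and N :: "'a::field_char_0 \<Rightarrow> real"
  assumes prime_p: "prime p"
    and norm_nonneg: "0 \<le> N x"
    and norm_eq_0_iff: "N x = 0 \<longleftrightarrow> x = 0"
    and norm_mult: "N (x * y) = N x * N y"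
    and norm_add_le_max: "N (x + y) \<le> max (N x) (N y)"
    and norm_p: "N (of_nat p) = 1 / real p"
    and complete: "mcomplete_of (nmetric N UNIV)"
    and dense_algebraic_closure:
      "\<exists>L. algebraic_closure ((ring_of_type_algebra :: 'a ring)\<lparr>carrier := L\<rparr>)
              (mtopology_of (nmetric N UNIV) closure_of \<rat>) \<and>
           mtopology_of (nmetric N UNIV) closure_of L = UNIV"

definition valuation_ring :: "('a::field_char_0 \<Rightarrow> real) \<Rightarrow> 'a set" where
  "valuation_ring N = {x. N x \<le> 1}"

text \<open>
  Discreteness refers to the valuation \<open>v x = - log\<^sub>p (N x)\<close> on the fraction field of \<open>R\<close>: the
  value group, which consists of the differences \<open>v x - v y\<close> with \<open>x, y\<close> nonzero in \<open>R\<close>, is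
  infinite cyclic.
\<close>

definition discretely_valued :: "nat \<Rightarrow> ('a::field_char_0 \<Rightarrow> real) \<Rightarrow> 'a set \<Rightarrow> bool" where
  "discretely_valued p N R \<longleftrightarrow>
     (\<exists>e::real. e > 0 \<and>
        {- log (real p) (N x) - (- log (real p) (N y)) | x y. x \<in> R - {0} \<and> y \<in> R - {0}}
          = range (\<lambda>k::int. e * of_int k))"

definition complete_discrete_subring ::
    "nat \<Rightarrow> ('a::field_char_0 \<Rightarrow> real) \<Rightarrow> 'a set \<Rightarrow> bool" where
  "complete_discrete_subring p N R \<longleftrightarrow>
     subring R (ring_of_type_algebra :: 'a ring) \<and> R \<subseteq> valuation_ring N \<and>
     mcomplete_of (nmetric N R) \<and> discretely_valued p N R"


section \<open>Horizontal pro-p groups\<close>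

text \<open>
  Groups are written multiplicatively, following HOL-Algebra; the topology is a separate
  component.
\<close>

locale abelian_profinite_group = comm_group G for G :: "('g, 'b) monoid_scheme" (structure) +
  fixes T :: "'g topology"
  assumes topspace_eq: "topspace T = carrier G"
    and continuous_mult: "continuous_map (prod_topology T T) T (\<lambda>(x, y). x \<otimes> y)"
    and continuous_inv: "continuous_map T T (\<lambda>x. inv x)"
    and compact: "compact_space T"
    and Hausdorff: "Hausdorff_space T"
    and totally_disconnected: "connectedin T S \<Longrightarrow> \<exists>a. S \<subseteq> {a}"

definition horizontal_pro_p ::
    "nat \<Rightarrow> ('g, 'b) monoid_scheme \<Rightarrow> 'g topology \<Rightarrow> bool" where
  "horizontal_pro_p p G T \<longleftrightarrow>
     abelian_profinite_group G T \<and>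
     (\<exists>m :: nat \<Rightarrow> nat. (\<forall>n. 1 \<le> m n) \<and>
       (\<exists>f. f \<in> iso G (product_group UNIV (\<lambda>n. integer_mod_group (p ^ m n))) \<and>
            homeomorphic_map T
              (product_topology
                 (\<lambda>n. discrete_topology (carrier (integer_mod_group (p ^ m n)))) UNIV) f))"

text \<open>The library's \<^const>\<open>group.ord\<close> is \<open>0\<close> at elements of infinite order.\<close>

definition log_exponent :: "nat \<Rightarrow> ('g, 'b) monoid_scheme \<Rightarrow> ereal" where
  "log_exponent p G =
     (SUP g\<in>carrier G.
        if group.ord G g = 0 then \<infinity> else ereal (log (real p) (real (group.ord G g))))"


section \<open>Characters\<close>

text \<open>
  \<open>C(G, A)\<close> with its sup-norm, as a metric space.  Its elements are \<^const>\<open>extensional\<close>; the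
  boundedness condition in \<^const>\<open>cfunspace\<close> is vacuous because \<open>G\<close> is compact.
\<close>

abbreviation continuous_functions ::
    "('a::field_char_0 \<Rightarrow> real) \<Rightarrow> 'g topology \<Rightarrow> 'a set \<Rightarrow> ('g \<Rightarrow> 'a) metric" where
  "continuous_functions N T A \<equiv> cfunspace T (nmetric N A)"

abbreviation valuation_unit_group :: "('a::field_char_0 \<Rightarrow> real) \<Rightarrow> 'a monoid" where
  "valuation_unit_group N \<equiv>
     units_of ((ring_of_type_algebra :: 'a ring)\<lparr>carrier := valuation_ring N\<rparr>)"

definition character_group ::
    "('a::field_char_0 \<Rightarrow> real) \<Rightarrow> ('g, 'b) monoid_scheme \<Rightarrow> 'g topology \<Rightarrow> ('g \<Rightarrow> 'a) monoid"
  where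
  "character_group N G T =
     \<lparr>carrier = hom G (valuation_unit_group N) \<inter>
                mspace (continuous_functions N T (carrier (valuation_unit_group N))),
      monoid.mult = (\<lambda>\<psi> \<theta>. \<lambda>g\<in>carrier G. \<psi> g * \<theta> g),
      one = (\<lambda>g\<in>carrier G. 1)\<rparr>"


section \<open>Iwasawa algebras and measures\<close>

definition open_subgroups :: "('g, 'b) monoid_scheme \<Rightarrow> 'g topology \<Rightarrow> 'g set set" where
  "open_subgroups G T = {H. subgroup H G \<and> openin T H}"

definition group_algebra :: "'a::field_char_0 set \<Rightarrow> ('h, 'c) monoid_scheme \<Rightarrow> ('h \<Rightarrow> 'a) set" where
  "group_algebra R Q = {a \<in> carrier Q \<rightarrow>\<^sub>E R. finite {x \<in> carrier Q. a x \<noteq> 0}}"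

text \<open>
  The inverse limit of the group algebras \<open>R[G/H]\<close> as a set of compatible families \<open>\<nu>\<close>, where
  \<open>\<nu> H C\<close> is the coefficient of the coset \<open>C\<close>.  For \<open>H \<subseteq> K\<close> the projection \<open>G/H \<rightarrow> G/K\<close> sends a
  coset of \<open>H\<close> to the coset of \<open>K\<close> containing it, so its extension to group algebras sums
  coefficients over the cosets of \<open>H\<close> contained in a given coset of \<open>K\<close>.
\<close>

definition iwasawa_algebra ::
    "'a::field_char_0 set \<Rightarrow> ('g, 'b) monoid_scheme \<Rightarrow> 'g topology \<Rightarrow> ('g set \<Rightarrow> 'g set \<Rightarrow> 'a) set"
  where
  "iwasawa_algebra R G T =
     {\<nu> \<in> (\<Pi>\<^sub>E H\<in>open_subgroups G T. group_algebra R (G Mod H)).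
        \<forall>H\<in>open_subgroups G T. \<forall>K\<in>open_subgroups G T. H \<subseteq> K \<longrightarrow>
          (\<forall>C\<in>carrier (G Mod K). \<nu> K C = (\<Sum>D | D \<in> carrier (G Mod H) \<and> D \<subseteq> C. \<nu> H D))}"

text \<open>The \<open>A\<close>-linear continuous maps from \<open>C(G, A)\<close> to \<open>A\<close>; here \<open>topspace T\<close> is \<open>G\<close>.\<close>

definition measures ::
    "('a::field_char_0 \<Rightarrow> real) \<Rightarrow> 'g topology \<Rightarrow> 'a set \<Rightarrow> (('g \<Rightarrow> 'a) \<Rightarrow> 'a) set" where
  "measures N T A =
     {\<mu> \<in> mspace (continuous_functions N T A) \<rightarrow>\<^sub>E A.
        (\<forall>\<phi>\<in>mspace (continuous_functions N T A). \<forall>\<psi>\<in>mspace (continuous_functions N T A).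
           \<mu> (\<lambda>g\<in>topspace T. \<phi> g + \<psi> g) = \<mu> \<phi> + \<mu> \<psi>) \<and>
        (\<forall>a\<in>A. \<forall>\<phi>\<in>mspace (continuous_functions N T A).
           \<mu> (\<lambda>g\<in>topspace T. a * \<phi> g) = a * \<mu> \<phi>) \<and>
        continuous_map (mtopology_of (continuous_functions N T A)) (mtopology_of (nmetric N A)) \<mu>}"

text \<open>
  The identification of the Iwasawa algebra with measures: the coefficient of \<open>\<nu>\<close> at a coset \<open>C\<close>
  of an open subgroup is the measure of the (open and closed) set \<open>C\<close>.  As \<open>iwasawa_algebra R G T\<close>
  is contained in \<open>iwasawa_algebra (valuation_ring N) G T\<close>, the measure is taken with values
  in \<^term>\<open>valuation_ring N\<close>, whatever the coefficient ring of \<open>\<nu>\<close>.  It is uniquely determined,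
  since locally constant functions are dense.
\<close>

definition measure_of_iwasawa ::
    "('a::field_char_0 \<Rightarrow> real) \<Rightarrow> ('g, 'b) monoid_scheme \<Rightarrow> 'g topology \<Rightarrow>
     ('g set \<Rightarrow> 'g set \<Rightarrow> 'a) \<Rightarrow> ('g \<Rightarrow> 'a) \<Rightarrow> 'a" where
  "measure_of_iwasawa N G T \<nu> =
     (THE \<mu>. \<mu> \<in> measures N T (valuation_ring N) \<and>
        (\<forall>H\<in>open_subgroups G T. \<forall>C\<in>carrier (G Mod H).
           \<mu> (\<lambda>g\<in>carrier G. indicator C g) = \<nu> H C))"

end

theory Submission
  imports Defs
begin

text \<open>
  Put \<open>q = p ^ e\<close>, where \<open>p ^ e\<close> kills \<open>G\<close>.  If \<open>\<nu>'\<close> is the convolution product of the push-forwards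
  of \<open>\<nu>\<close> along the power maps \<open>g \<mapsto> g ^ i\<close> for \<open>i < q\<close>, then \<open>\<nu>'(\<xi>)\<close> is the product of the values
  \<open>\<nu>(\<xi> ^ i)\<close>, so it suffices to twist an arbitrary character \<open>\<psi>\<close> to one at which \<open>\<nu>'\<close> does not
  vanish.  As \<open>\<nu>'(1) = \<nu>(1) ^ q\<close> is nonzero, so is \<open>\<nu>'\<close>, and because its values lie in a discretely
  valued ring, there is a coset \<open>C\<close> of an open subgroup \<open>H\<close> at which \<open>\<nu>'\<close> has maximal absolute value.
  Let \<open>M\<close> be the finite group of characters of \<open>G/H\<close>.  Values of characters are \<open>q\<close>-th roots of unity
  and hence congruent to \<open>1\<close> modulo the maximal ideal, so the integral of \<open>\<psi>\<close> over \<open>C\<close> has the same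
  absolute value as \<open>\<nu>'(C)\<close>.  By Fourier inversion on \<open>G/H\<close> it is a linear combination of the values
  \<open>\<nu>'(\<psi> \<xi>)\<close> for \<open>\<xi> \<in> M\<close>, which therefore do not all vanish.
\<close>

section \<open>Non-archimedean estimates and roots of unity\<close>

text \<open>The group M has to be fixed before \<psi>, but \<psi> may be constant only on cosets far
  smaller than those of H. Maximality of the coset C is therefore required among the cosets of all
  levels at once. This is an infinite family, and a discrete valuation is what lets its norms attain
  their supremum. For such a C, \<nu>'(C) is the sum of \<nu>'(D) over the small cosets D inside C,
  none of them larger in norm than \<nu>'(C). Inserting the weights \<psi>(D) changes each term by
  strictly less than the norm of \<nu>'(C), so by the ultrametric inequality the sum cannot become
  0. Only the coefficients of \<nu>' are compared in R; values of characters are taken in the large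
  field. Bounded exponent acts in three ways: it leaves only q powers to control, it makes
  continuous characters locally constant, and it puts their values in the residue class of 1. Since
  characters are locally constant, every value of \<nu> that occurs is a finite sum over one
  level.\<close>

lemma finite_roots_of_unity:
  assumes "0 < n"
  shows "finite {x::'a::idom. x ^ n = 1}"
proof -
  have "monom (1::'a) n - 1 \<noteq> 0"
  proof
    assume "monom (1::'a) n - 1 = 0"
    then have "coeff (monom (1::'a) n - 1) n = 0"
      by simp
    then show False
      using assms by simp
  qed
  then have "finite {x::'a. poly (monom 1 n - 1) x = 0}"
    by (rule poly_roots_finite)
  then show ?thesis
    by (simp add: poly_monom)
qed

lemma subring_type_algebraD:
  assumes "subring R (ring_of_type_algebra :: 'a::comm_ring_1 ring)"
  shows "0 \<in> R" "1 \<in> R" "x \<in> R \<Longrightarrow> y \<in> R \<Longrightarrow> x + y \<in> R" "x \<in> R \<Longrightarrow> y \<in> R \<Longrightarrow> x * y \<in> R"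
  using subringE(2,3,6,7)[OF assms] by (auto simp: ring_of_type_algebra_def)

lemma iwasawa_algebra_mono: "R \<subseteq> S \<Longrightarrow> iwasawa_algebra R G T \<subseteq> iwasawa_algebra S G T"
proof
  fix \<nu> assume "R \<subseteq> S" and \<nu>: "\<nu> \<in> iwasawa_algebra R G T"
  then have "group_algebra R Q \<subseteq> group_algebra S Q" for Q :: "'g set monoid"
    unfolding group_algebra_def by (auto simp: PiE_iff)
  then have "(\<Pi>\<^sub>E H\<in>open_subgroups G T. group_algebra R (G Mod H)) \<subseteq>
      (\<Pi>\<^sub>E H\<in>open_subgroups G T. group_algebra S (G Mod H))"
    by (rule PiE_mono)
  then show "\<nu> \<in> iwasawa_algebra S G T"
    using \<nu> unfolding iwasawa_algebra_def by blast
qed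

section \<open>Ultrametric estimates, discrete valuations and p-power roots of unity\<close>

context padic_complex_field
begin

lemma norm_zero [simp]: "N 0 = 0"
  by (simp add: norm_eq_0_iff)

lemma norm_pos_iff: "0 < N x \<longleftrightarrow> x \<noteq> 0"
  using norm_nonneg[of x] norm_eq_0_iff[of x] by linarith

lemma norm_one [simp]: "N 1 = 1"
  using norm_mult[of 1 1] norm_eq_0_iff[of 1] by simp

lemma norm_power: "N (x ^ n) = N x ^ n"
  by (induction n) (auto simp: norm_mult)

lemma norm_minus [simp]: "N (- x) = N x"
proof -
  have "N (-1) ^ 2 = 1"
    using norm_mult[of "-1" "-1"] by (simp add: power2_eq_square)
  then have "N (-1) = 1"
    using norm_nonneg[of "-1"] by (simp add: power2_eq_1_iff)
  then show ?thesis
    using norm_mult[of "-1" x] by simp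
qed

lemma norm_minus_commute: "N (x - y) = N (y - x)"
  using norm_minus[of "x - y"] by simp

lemma norm_add_le: "N x \<le> B \<Longrightarrow> N y \<le> B \<Longrightarrow> N (x + y) \<le> B"
  using norm_add_le_max[of x y] by linarith

lemma norm_diff_le: "N x \<le> B \<Longrightarrow> N y \<le> B \<Longrightarrow> N (x - y) \<le> B"
  using norm_add_le[of x B "- y"] by simp

lemma norm_diff_less: "N x < B \<Longrightarrow> N y < B \<Longrightarrow> N (x - y) < B"
  using norm_add_le_max[of x "- y"] by simp

lemma norm_diff_triangle_le: "N (x - y) \<le> B \<Longrightarrow> N (y - z) \<le> B \<Longrightarrow> N (x - z) \<le> B"
  using norm_add_le[of "x - y" B "y - z"] by simp

lemma norm_diff_triangle_less: "N (x - y) < B \<Longrightarrow> N (y - z) < B \<Longrightarrow> N (x - z) < B"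
  using norm_diff_less[of "x - y" B "z - y"] by (simp add: norm_minus_commute)

lemma norm_sum_le:
  assumes "0 \<le> B" "\<And>i. i \<in> A \<Longrightarrow> N (f i) \<le> B"
  shows "N (sum f A) \<le> B"
  using assms(2)
  by (induction A rule: infinite_finite_induct) (auto simp: assms(1) intro!: norm_add_le)

lemma norm_sum_less:
  assumes "0 < B" "\<And>i. i \<in> A \<Longrightarrow> N (f i) < B"
  shows "N (sum f A) < B"
  using assms(2)
proof (induction A rule: infinite_finite_induct)
  case (insert x F)
  then show ?case
    using le_less_trans[OF norm_add_le_max[of "f x" "sum f F"]] by simp
qed (use assms(1) in auto)

lemma norm_of_nat_le_1: "N (of_nat n) \<le> 1"
  by (induction n) (auto intro!: norm_add_le)

lemma p_gt_1: "1 < p"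
  using prime_p prime_gt_1_nat by blast

lemma norm_of_nat_dvd_less: "p dvd n \<Longrightarrow> N (of_nat n) < 1"
proof -
  assume "p dvd n"
  then obtain k where "n = p * k" by blast
  then have "N (of_nat n) = (1 / real p) * N (of_nat k)"
    by (simp add: norm_mult norm_p)
  also have "\<dots> \<le> 1 / real p"
    using norm_of_nat_le_1[of k] p_gt_1 by (simp add: field_simps)
  also have "\<dots> < 1"
    using p_gt_1 by simp
  finally show ?thesis .
qed

text \<open>Frobenius is injective on the residue field: with y = x - 1, the inner binomial
  coefficients of (y + 1)^p are divisible by p, so x^p - 1 and y^p agree modulo the maximal ideal,
  and N y ^ p < 1 forces N y < 1.\<close>

lemma norm_minus_one_less_if_power_p:
  assumes "N x \<le> 1" "N (x ^ p - 1) < 1"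
  shows "N (x - 1) < 1"
proof -
  define y where "y = x - 1"
  have y: "N y \<le> 1"
    unfolding y_def using assms(1) by (intro norm_diff_le) auto
  have "x ^ p = (y + 1) ^ p"
    by (simp add: y_def)
  also have "\<dots> = (\<Sum>k\<le>p. of_nat (p choose k) * y ^ k)"
    by (subst binomial_ring) simp
  also have "{..p} = insert 0 (insert p {0<..<p})"
    using p_gt_1 by auto
  also have "(\<Sum>k\<in>insert 0 (insert p {0<..<p}). of_nat (p choose k) * y ^ k) =
      1 + (y ^ p + (\<Sum>k\<in>{0<..<p}. of_nat (p choose k) * y ^ k))"
    using p_gt_1 by (subst sum.insert; simp)+
  finally have "y ^ p = (x ^ p - 1) - (\<Sum>k\<in>{0<..<p}. of_nat (p choose k) * y ^ k)"
    by (simp add: algebra_simps)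
  also have "N \<dots> < 1"
  proof (rule norm_diff_less[OF assms(2) norm_sum_less])
    fix k assume k: "k \<in> {0<..<p}"
    then have "p dvd (p choose k)"
      using prime_p by (intro dvd_choose_prime) auto
    then have "N (of_nat (p choose k)) < 1"
      by (rule norm_of_nat_dvd_less)
    moreover have "N (y ^ k) \<le> 1"
      using y norm_nonneg by (simp add: norm_power power_le_one)
    ultimately show "N (of_nat (p choose k) * y ^ k) < 1"
      using mult_left_le[of "N (y ^ k)" "N (of_nat (p choose k))"] norm_nonneg
      by (simp add: norm_mult)
  qed simp
  finally have "N y ^ p < 1"
    by (simp add: norm_power)
  then show ?thesis
    using y_def p_gt_1 norm_nonneg one_le_power[of "N y" p] by (meson not_le)
qed

lemma norm_root_of_unity:
  assumes "x ^ n = 1" "0 < n"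
  shows "N x = 1"
proof -
  have "N x ^ n = 1"
    using assms(1) by (metis norm_one norm_power)
  then show ?thesis
    using norm_nonneg[of x] assms(2) by (metis power_eq_iff_eq_base power_one zero_le_one)
qed

text \<open>Extracting a p-th root preserves congruence to 1 modulo the maximal ideal, so e
  extractions starting from 1 stay in that residue class.\<close>

lemma norm_root_of_unity_minus_one_less:
  assumes "x ^ (p ^ e) = 1"
  shows "N (x - 1) < 1"
  using assms
proof (induction e arbitrary: x)
  case (Suc e)
  have "N (x ^ p - 1) < 1"
    using Suc.IH[of "x ^ p"] Suc.prems by (simp add: power_mult)
  moreover have "N x = 1"
    using norm_root_of_unity[OF Suc.prems] p_gt_1 by simp
  ultimately show ?case
    using norm_minus_one_less_if_power_p by simp
qed auto

text \<open>On nonzero elements of R the valuation is d times a natural number, so it has a least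
  value on S even if S is infinite; least valuation means largest norm.\<close>

lemma discretely_valued_attains_max:
  assumes "discretely_valued p N R" "1 \<in> R" "R \<subseteq> valuation_ring N" "S \<subseteq> R" "x \<in> S" "x \<noteq> 0"
  obtains y where "y \<in> S" "y \<noteq> 0" "\<And>z. z \<in> S \<Longrightarrow> N z \<le> N y"
proof -
  obtain d :: real where d_conj: "0 < d \<and>
      {- log (real p) (N x) - (- log (real p) (N y)) | x y. x \<in> R - {0} \<and> y \<in> R - {0}}
        = range (\<lambda>k::int. d * of_int k)"
    using assms(1) unfolding discretely_valued_def by (rule exE)
  note d = d_conj[THEN conjunct1] d_conj[THEN conjunct2]
  have "\<exists>k::nat. - log (real p) (N y) = d * real k" if y: "y \<in> R" "y \<noteq> 0" for y
  proof -
    \<comment> \<open>The value group consists of differences of valuations; pairing y with 1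
      recovers the valuation of y itself.\<close>
    have "- log (real p) (N y) - (- log (real p) (N 1)) \<in> range (\<lambda>k::int. d * of_int k)"
      unfolding d(2)[symmetric]
      by (rule CollectI, rule exI[of _ y], rule exI[of _ 1]) (use y assms(2) in simp)
    then obtain k :: int where k: "- log (real p) (N y) = d * of_int k"
      by (auto simp del: of_int_mult)
    have "0 < N y" "N y \<le> 1"
      using y assms(3) by (auto simp: norm_pos_iff valuation_ring_def)
    then have "log (real p) (N y) \<le> 0"
      using p_gt_1 by simp
    then have "0 \<le> d * of_int k"
      using k by linarith
    then have "0 \<le> k"
      using d(1) by (simp add: zero_le_mult_iff)
    then have "- log (real p) (N y) = d * real (nat k)"
      using k by simp
    then show ?thesis by blast
  qed
  then obtain v :: "'a \<Rightarrow> nat" where v: "\<And>y. y \<in> R \<Longrightarrow> y \<noteq> 0 \<Longrightarrow> - log (real p) (N y) = d * real (v y)"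
    by metis
  obtain y where y: "y \<in> S" "y \<noteq> 0" "\<And>z. z \<in> S \<Longrightarrow> z \<noteq> 0 \<Longrightarrow> v y \<le> v z"
    using ex_has_least_nat[of "\<lambda>y. y \<in> S \<and> y \<noteq> 0" x v] assms(5,6) by blast
  have "N z \<le> N y" if z: "z \<in> S" for z
  proof (cases "z = 0")
    case False
    then have "d * real (v y) \<le> d * real (v z)"
      using y(3)[OF z] d(1) by simp
    moreover have "- log (real p) (N y) = d * real (v y)" "- log (real p) (N z) = d * real (v z)"
      using v y z False assms(4) by blast+
    ultimately have "log (real p) (N z) \<le> log (real p) (N y)"
      by linarith
    then show ?thesis
      using p_gt_1 y(2) False by (simp add: norm_pos_iff)
  qed (simp add: norm_nonneg)
  then show thesis
    using that y by blast
qed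

text \<open>Translates root existence from HOL-Algebra polynomials to ordinary sums. Coefficient
  lists start with the leading coefficient, whence the exponent
  \<open>length cs - Suc i\<close>.\<close>

lemma algebraically_closed_subset:
  obtains L :: "'a set" where "0 \<in> L" "1 \<in> L" "\<And>x. x \<in> L \<Longrightarrow> - x \<in> L"
    "\<And>cs. set cs \<subseteq> L \<Longrightarrow> cs \<noteq> [] \<Longrightarrow> hd cs \<noteq> 0 \<Longrightarrow> length cs > 1 \<Longrightarrow>
      \<exists>x\<in>L. (\<Sum>i<length cs. cs ! i * x ^ (length cs - Suc i)) = 0"
proof -
  obtain L :: "'a set" where
    "algebraic_closure ((ring_of_type_algebra :: 'a ring)\<lparr>carrier := L\<rparr>)
       (mtopology_of (nmetric N UNIV) closure_of \<rat>)"
    using dense_algebraic_closure by blast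
  then interpret C: algebraic_closure "(ring_of_type_algebra :: 'a ring)\<lparr>carrier := L\<rparr>"
    "mtopology_of (nmetric N UNIV) closure_of \<rat>" .
  let ?C = "(ring_of_type_algebra :: 'a ring)\<lparr>carrier := L\<rparr>"
  have simps [simp]: "carrier ?C = L" "\<one>\<^bsub>?C\<^esub> = 1" "\<zero>\<^bsub>?C\<^esub> = 0"
    "(\<otimes>\<^bsub>?C\<^esub>) = (*)" "(\<oplus>\<^bsub>?C\<^esub>) = (+)"
    by (auto simp: ring_of_type_algebra_def fun_eq_iff)
  have pow: "x [^]\<^bsub>?C\<^esub> (n::nat) = x ^ n" for x n
    by (induction n) (auto simp: nat_pow_def)
  have eval: "C.eval cs x = (\<Sum>i<length cs. cs ! i * x ^ (length cs - Suc i))" for cs x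
  proof (induction cs)
    case (Cons c cs)
    have "C.eval (c # cs) x = c * x ^ length cs + C.eval cs x"
      by (simp add: pow)
    also have "\<dots> = (\<Sum>i<length (c # cs). (c # cs) ! i * x ^ (length (c # cs) - Suc i))"
      unfolding Cons.IH by (simp add: sum.lessThan_Suc_shift del: sum.lessThan_Suc)
    finally show ?case .
  qed simp
  show thesis
  proof (rule that)
    show "0 \<in> L"
      using C.zero_closed by simp
    show "1 \<in> L"
      using C.one_closed C.subset by auto
    show "- x \<in> L" if "x \<in> L" for x
    proof -
      have "\<ominus>\<^bsub>?C\<^esub> x \<in> L" "x \<oplus>\<^bsub>?C\<^esub> (\<ominus>\<^bsub>?C\<^esub> x) = \<zero>\<^bsub>?C\<^esub>"
        using C.a_inv_closed[of x] C.r_neg[of x] that by (simp_all del: simps(5) simps(3))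
      then show ?thesis
        by (metis add_eq_0_iff simps(3,5))
    qed
    show "\<exists>x\<in>L. (\<Sum>i<length cs. cs ! i * x ^ (length cs - Suc i)) = 0"
      if "set cs \<subseteq> L" "cs \<noteq> []" "hd cs \<noteq> 0" "length cs > 1" for cs
    proof -
      have cs: "cs \<in> carrier (poly_ring ?C)"
        using that by (auto simp: univ_poly_def polynomial_def)
      then have "C.splitted cs"
        by (rule C.roots_over_carrier)
      \<comment> \<open>A split polynomial has as many roots as its degree, here
        \<open>length cs - 1\<close>, which is positive.\<close>
      then have "size (C.roots cs) > 0"
        using that by (simp add: C.splitted_def)
      then obtain x where "x \<in># C.roots cs"
        by (metis gr_implies_not_zero multiset_nonemptyE size_empty)
      then have "C.is_root cs x"
        using C.roots_mem_iff_is_root[OF cs] by simp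
      then show ?thesis
        unfolding C.is_root_def by (auto simp: eval)
    qed
  qed
qed

text \<open>Supplies enough values for characters to separate points. A p-th root of 1 may be 1
  again, so the passage from order 1 to order p uses a root of 1 + X + ... + X^(p-1); afterwards
  every p-th root of a primitive root is primitive.\<close>

lemma exists_primitive_root_of_unity:
  "\<exists>\<zeta>::'a. \<zeta> ^ (p ^ e) = 1 \<and> (\<forall>j::nat. \<zeta> ^ j = 1 \<longrightarrow> p ^ e dvd j)"
proof -
  obtain L :: "'a set" where L0: "0 \<in> L" and L1: "1 \<in> L" and Lm: "\<And>x. x \<in> L \<Longrightarrow> - x \<in> L"
    and Lr: "\<And>cs. set cs \<subseteq> L \<Longrightarrow> cs \<noteq> [] \<Longrightarrow> hd cs \<noteq> 0 \<Longrightarrow> length cs > 1 \<Longrightarrow>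
      \<exists>x\<in>L. (\<Sum>i<length cs. cs ! i * x ^ (length cs - Suc i)) = 0"
    using algebraically_closed_subset by metis
  have root: "\<exists>x\<in>L. x ^ p = c" if c: "c \<in> L" for c
  proof -
    \<comment> \<open>Coefficients of X^p - c.\<close>
    define cs where "cs = 1 # replicate (p - 1) 0 @ [- c]"
    have len: "length cs = Suc p"
      using p_gt_1 by (simp add: cs_def)
    have "set cs \<subseteq> L"
      using L1 L0 Lm[OF c] by (auto simp: cs_def)
    then have "\<exists>x\<in>L. (\<Sum>i<length cs. cs ! i * x ^ (length cs - Suc i)) = 0"
      by (rule Lr) (use p_gt_1 in \<open>simp_all add: cs_def\<close>)
    then obtain x where x: "x \<in> L" "(\<Sum>i<Suc p. cs ! i * x ^ (Suc p - Suc i)) = 0"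
      unfolding len by blast
    have "(\<Sum>i<p. cs ! i * x ^ (p - i)) = (\<Sum>i<p. if i = 0 then x ^ p else 0)"
      by (intro sum.cong) (auto simp: cs_def nth_append nth_Cons')
    also have "\<dots> = x ^ p"
      using p_gt_1 by simp
    moreover have "cs ! p = - c"
      using p_gt_1 by (simp add: cs_def nth_append nth_Cons')
    ultimately have "x ^ p = c"
      using x(2) by (simp add: len)
    then show ?thesis using x(1) by blast
  qed
  have "\<exists>\<zeta>\<in>L. \<zeta> ^ (p ^ e) = 1 \<and> (\<forall>j. \<zeta> ^ j = 1 \<longrightarrow> p ^ e dvd j)"
  proof (induction e)
    case 0
    then show ?case using L1 by auto
  next
    case (Suc e)
    show ?case
    proof (cases "e = 0")
      case True
      \<comment> \<open>Coefficients of 1 + X + ... + X^(p-1).\<close>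
      define cs where "cs = replicate p (1::'a)"
      have "\<exists>x\<in>L. (\<Sum>i<length cs. cs ! i * x ^ (length cs - Suc i)) = 0"
        by (rule Lr) (use p_gt_1 L1 in \<open>auto simp: cs_def\<close>)
      then obtain x where x: "x \<in> L" "(\<Sum>i<p. x ^ (p - Suc i)) = 0"
        by (auto simp: cs_def)
      have sum0: "(\<Sum>i<p. x ^ i) = 0"
        using x(2) sum.nat_diff_reindex[of "\<lambda>i. x ^ i" p] by simp
      have xp: "x ^ p = 1"
        using power_diff_1_eq[of x p] sum0 by simp
      \<comment> \<open>At x = 1 the sum would be p, which is nonzero in characteristic 0.\<close>
      have x1: "x \<noteq> 1"
        using sum0 p_gt_1 by auto
      have "p dvd j" if "x ^ j = 1" for j
      proof (rule ccontr)
        assume "\<not> p dvd j"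
        then have "coprime j p"
          using prime_p by (metis coprime_commute prime_imp_coprime)
        then obtain a b where "j * a = p * b + 1"
          using bezout_nat[of j p] \<open>\<not> p dvd j\<close> by (metis coprime_imp_gcd_eq_1 dvd_0_right)
        then have "x ^ (j * a) = x ^ (p * b + 1)" by simp
        then show False
          using that xp x1 by (simp add: power_mult)
      qed
      then show ?thesis
        using x(1) xp True by auto
    next
      case False
      obtain z where z: "z \<in> L" "z ^ (p ^ e) = 1" "\<And>j. z ^ j = 1 \<Longrightarrow> p ^ e dvd j"
        using Suc.IH by blast
      obtain x where x: "x \<in> L" "x ^ p = z"
        using root[OF z(1)] by blast
      have "p ^ Suc e dvd j" if j: "x ^ j = 1" for j
      proof -
        have "z ^ j = (x ^ j) ^ p"
          using x(2) by (metis power_mult mult.commute)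
        then have "p ^ e dvd j"
          using z(3) j by simp
        \<comment> \<open>Here \<open>e \<noteq> 0\<close> enters: it makes p a divisor of
          \<open>p ^ e\<close>. Dividing j by p then returns to the order of z.\<close>
        then have "p dvd j"
          using False by (meson dvd_power dvd_trans gr0I)
        then obtain k where k: "j = p * k" by blast
        then have "z ^ k = 1"
          using j x(2) by (simp add: power_mult)
        then show ?thesis
          using z(3) k by simp
      qed
      moreover have "x ^ (p ^ Suc e) = 1"
        using x(2) z(2) by (simp add: power_mult)
      ultimately show ?thesis
        using x(1) by blast
    qed
  qed
  then show ?thesis by blast
qed

end

section \<open>Groups with compatible truncations\<close>

text \<open>
  \<open>trunc k\<close> models the projection to a finite quotient \<open>G/H\<^sub>k\<close> followed by a splitting \<open>G/H\<^sub>k \<rightarrow> G\<close>, so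
  that sums over cosets become sums over the finite subgroup \<open>level k\<close> of \<open>G\<close>.
\<close>

locale profinite_truncations = comm_group G for G :: "('g, 'b) monoid_scheme" (structure) +
  fixes T :: "'g topology" and trunc :: "nat \<Rightarrow> 'g \<Rightarrow> 'g"
  assumes topspace_eq: "topspace T = carrier G"
    and compact: "compact_space T"
    and trunc_hom: "trunc k \<in> hom G G"
    and trunc_trunc: "x \<in> carrier G \<Longrightarrow> trunc k (trunc l x) = trunc (min k l) x"
    and finite_range_trunc: "finite (trunc k ` carrier G)"
    and open_fiber: "x \<in> carrier G \<Longrightarrow> openin T {y \<in> carrier G. trunc k y = trunc k x}"
    and fiber_basis:
      "openin T U \<Longrightarrow> x \<in> U \<Longrightarrow> \<exists>k. {y \<in> carrier G. trunc k y = trunc k x} \<subseteq> U"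
begin

definition level :: "nat \<Rightarrow> 'g set" where
  "level k = trunc k ` carrier G"

definition ker :: "nat \<Rightarrow> 'g set" where
  "ker k = {x \<in> carrier G. trunc k x = \<one>}"

lemma trunc_closed [simp]: "x \<in> carrier G \<Longrightarrow> trunc k x \<in> carrier G"
  using trunc_hom by (auto simp: hom_def)

lemma trunc_mult: "x \<in> carrier G \<Longrightarrow> y \<in> carrier G \<Longrightarrow> trunc k (x \<otimes> y) = trunc k x \<otimes> trunc k y"
  using trunc_hom by (auto simp: hom_def)

lemma trunc_group_hom: "group_hom G G (trunc k)"
  using trunc_hom by (intro group_hom.intro group_hom_axioms.intro is_group)

lemma trunc_one [simp]: "trunc k \<one> = \<one>"
  by (rule group_hom.hom_one[OF trunc_group_hom])

lemma trunc_inv: "x \<in> carrier G \<Longrightarrow> trunc k (inv x) = inv (trunc k x)"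
  by (rule group_hom.hom_inv[OF trunc_group_hom])

lemma trunc_pow: "x \<in> carrier G \<Longrightarrow> trunc k (x [^] (n::nat)) = trunc k x [^] n"
  by (rule group_hom.hom_nat_pow[OF trunc_group_hom])

lemma trunc_finprod:
  "f \<in> A \<rightarrow> carrier G \<Longrightarrow> trunc k (\<Otimes>i\<in>A. f i) = (\<Otimes>i\<in>A. trunc k (f i))"
  by (induction A rule: infinite_finite_induct) (auto simp: trunc_mult Pi_def)

lemma finite_level [simp]: "finite (level k)"
  by (simp add: level_def finite_range_trunc)

lemma level_closed: "t \<in> level k \<Longrightarrow> t \<in> carrier G"
  by (auto simp: level_def)

lemma trunc_in_level [simp]: "x \<in> carrier G \<Longrightarrow> trunc k x \<in> level k"
  by (simp add: level_def)

lemma trunc_level: "t \<in> level k \<Longrightarrow> k \<le> l \<Longrightarrow> trunc l t = t"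
  by (auto simp: level_def trunc_trunc)

lemma trunc_eq_mono:
  assumes "trunc l x = trunc l y" "k \<le> l" "x \<in> carrier G" "y \<in> carrier G"
  shows "trunc k x = trunc k y"
  using assms trunc_trunc[of x k l] trunc_trunc[of y k l] by simp

lemma level_pow: "t \<in> level k \<Longrightarrow> t [^] (n::nat) \<in> level k"
  by (auto simp: level_def trunc_pow[symmetric])

text \<open>By idempotence, \<open>level k\<close> is the fixed-point set of the endomorphism
  \<open>trunc k\<close>.\<close>

lemma level_finprod: "f \<in> A \<rightarrow> level k \<Longrightarrow> (\<Otimes>i\<in>A. f i) \<in> level k"
proof -
  assume f: "f \<in> A \<rightarrow> level k"
  then have "trunc k (\<Otimes>i\<in>A. f i) = (\<Otimes>i\<in>A. trunc k (f i))"
    by (intro trunc_finprod) (auto dest: level_closed)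
  also have "\<dots> = (\<Otimes>i\<in>A. f i)"
    using f trunc_level by (intro finprod_cong') (auto simp: Pi_iff dest: level_closed)
  finally show ?thesis
    using f trunc_in_level[OF finprod_closed[of f A], of k] level_closed by (metis Pi_iff)
qed

lemma subgroup_ker: "subgroup (ker k) G"
  by (rule subgroupI) (auto simp: ker_def trunc_mult trunc_inv intro: exI[of _ \<one>])

lemma ker_mono: "k \<le> l \<Longrightarrow> ker l \<subseteq> ker k"
  using trunc_eq_mono[of l _ \<one> k] by (auto simp: ker_def)

lemma ker_open_subgroup: "ker k \<in> open_subgroups G T"
  using subgroup_ker open_fiber[of \<one> k] by (simp add: open_subgroups_def ker_def)

lemma ker_rcoset:
  assumes "x \<in> carrier G"
  shows "ker k #> x = {y \<in> carrier G. trunc k y = trunc k x}"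
proof
  show "ker k #> x \<subseteq> {y \<in> carrier G. trunc k y = trunc k x}"
    using assms by (auto simp: r_coset_def ker_def trunc_mult)
  show "{y \<in> carrier G. trunc k y = trunc k x} \<subseteq> ker k #> x"
  proof clarify
    fix y assume y: "y \<in> carrier G" "trunc k y = trunc k x"
    then have "y \<otimes> inv x \<in> ker k"
      using assms by (simp add: ker_def trunc_mult trunc_inv)
    moreover have "y = (y \<otimes> inv x) \<otimes> x"
      using y assms by (simp add: m_assoc)
    ultimately show "y \<in> ker k #> x"
      unfolding r_coset_def by blast
  qed
qed

text \<open>By idempotence x and \<open>trunc k x\<close> lie in the same coset, so
  \<open>level k\<close> meets every coset of \<open>ker k\<close>.\<close>

lemma rcosets_ker: "carrier (G Mod ker k) = (\<lambda>t. ker k #> t) ` level k"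
proof -
  have "ker k #> x = ker k #> trunc k x" if "x \<in> carrier G" for x
    using that by (simp add: ker_rcoset trunc_trunc)
  then show ?thesis
    unfolding FactGroup_def RCOSETS_def level_def by auto
qed

lemma inj_on_ker_rcoset: "inj_on (\<lambda>t. ker k #> t) (level k)"
proof (rule inj_onI)
  fix s t assume st: "s \<in> level k" "t \<in> level k" "ker k #> s = ker k #> t"
  have "s \<in> ker k #> s"
    using st(1) by (simp add: ker_rcoset level_closed)
  then have "trunc k s = trunc k t"
    unfolding st(3) using st(2) by (simp add: ker_rcoset level_closed)
  then show "s = t"
    using st by (simp add: trunc_level)
qed

text \<open>The subgroups \<open>ker k\<close> are the fibres through the identity, hence a
  neighbourhood basis there; all later ones are included because they decrease.\<close>

lemma open_subgroup_contains_ker: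
  assumes "H \<in> open_subgroups G T"
  obtains k where "\<And>l. k \<le> l \<Longrightarrow> ker l \<subseteq> H"
proof -
  have "\<one> \<in> H" "openin T H"
    using assms by (auto simp: open_subgroups_def subgroup.one_closed)
  then obtain k where "{y \<in> carrier G. trunc k y = trunc k \<one>} \<subseteq> H"
    using fiber_basis by blast
  then have "ker k \<subseteq> H"
    by (simp add: ker_def)
  then show thesis
    using that ker_mono by blast
qed

lemma rcoset_subset_iff:
  assumes K: "subgroup K G" "ker l \<subseteq> K" "C \<in> carrier (G Mod K)" "t \<in> carrier G"
  shows "ker l #> t \<subseteq> C \<longleftrightarrow> t \<in> C"
proof
  show "t \<in> C" if "ker l #> t \<subseteq> C"
    using that K(4) by (auto simp: ker_rcoset)
  show "ker l #> t \<subseteq> C" if "t \<in> C"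
  proof -
    obtain c where c: "c \<in> carrier G" "C = K #> c"
      using K(3) by (auto simp: FactGroup_def RCOSETS_def)
    then have "C = K #> t"
      using repr_independence[of t K c] that K(1) by simp
    then show ?thesis
      using K(2) by (auto simp: r_coset_def)
  qed
qed

text \<open>A coset of the smaller subgroup \<open>ker l\<close> lies in C exactly when its
  representative does, so the compatibility condition becomes a sum over points.\<close>

lemma iwasawa_coset_sum:
  assumes \<nu>: "\<nu> \<in> iwasawa_algebra R G T"
    and K: "K \<in> open_subgroups G T" "ker l \<subseteq> K" "C \<in> carrier (G Mod K)"
  shows "\<nu> K C = (\<Sum>t\<in>level l \<inter> C. \<nu> (ker l) (ker l #> t))"
proof -
  have sub: "subgroup K G"
    using K(1) by (simp add: open_subgroups_def)
  have "\<nu> K C = (\<Sum>D | D \<in> carrier (G Mod ker l) \<and> D \<subseteq> C. \<nu> (ker l) D)"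
    using \<nu> K ker_open_subgroup unfolding iwasawa_algebra_def by blast
  also have "{D. D \<in> carrier (G Mod ker l) \<and> D \<subseteq> C} = (\<lambda>t. ker l #> t) ` (level l \<inter> C)"
    unfolding rcosets_ker using rcoset_subset_iff[OF sub K(2,3) level_closed] by blast
  also have "(\<Sum>D\<in>\<dots>. \<nu> (ker l) D) = (\<Sum>t\<in>level l \<inter> C. \<nu> (ker l) (ker l #> t))"
    by (subst sum.reindex) (auto intro: inj_on_subset[OF inj_on_ker_rcoset])
  finally show ?thesis .
qed

text \<open>The mass of the fibre of \<open>trunc k\<close> over t, indexed by a representative
  instead of a coset.\<close>

definition coset_coeff :: "('g set \<Rightarrow> 'g set \<Rightarrow> 'a) \<Rightarrow> nat \<Rightarrow> 'g \<Rightarrow> 'a" where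
  "coset_coeff \<nu> k t = \<nu> (ker k) (ker k #> t)"

lemma coset_coeff_in:
  assumes "\<nu> \<in> iwasawa_algebra R G T" "t \<in> level k"
  shows "coset_coeff \<nu> k t \<in> R"
proof -
  have "\<nu> (ker k) \<in> group_algebra R (G Mod ker k)"
    using assms(1) ker_open_subgroup[of k] unfolding iwasawa_algebra_def by blast
  moreover have "ker k #> t \<in> carrier (G Mod ker k)"
    using assms(2) by (simp add: rcosets_ker)
  ultimately show ?thesis
    unfolding group_algebra_def coset_coeff_def by (blast dest: PiE_mem)
qed

text \<open>The points of \<open>level l\<close> in the coset of t are exactly those that
  \<open>trunc k\<close> sends to t.\<close>

lemma coset_coeff_compat:
  assumes "\<nu> \<in> iwasawa_algebra R G T" "t \<in> level k" "k \<le> l"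
  shows "coset_coeff \<nu> k t = (\<Sum>s | s \<in> level l \<and> trunc k s = t. coset_coeff \<nu> l s)"
proof -
  have "level l \<inter> (ker k #> t) = {s. s \<in> level l \<and> trunc k s = t}"
    using assms(2) by (auto simp: ker_rcoset level_closed trunc_level)
  then show ?thesis
    using iwasawa_coset_sum[OF assms(1) ker_open_subgroup ker_mono[OF assms(3)], of "ker k #> t"]
      assms(2) by (simp add: coset_coeff_def rcosets_ker)
qed

end

section \<open>Continuity, convergence and limits for the metric given by \<open>N\<close>\<close>

context padic_complex_field
begin

lemma Metric_space_norm: "Metric_space A (\<lambda>x y. N (x - y))"
proof
  show "N (x - z) \<le> N (x - y) + N (y - z)" for x y z
    using norm_add_le_max[of "x - y" "y - z"] norm_nonneg[of "x - y"] norm_nonneg[of "y - z"]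
    by simp
qed (auto simp: norm_nonneg norm_eq_0_iff norm_minus_commute)

lemma mspace_nmetric [simp]: "mspace (nmetric N A) = A"
  using Metric_space_norm by (simp add: nmetric_def Metric_space.mspace_metric)

lemma mdist_nmetric [simp]: "mdist (nmetric N A) = (\<lambda>x y. N (x - y))"
  using Metric_space_norm by (simp add: nmetric_def Metric_space.mdist_metric)

text \<open>Balls of the metric space A contain only points of A, so the codomain condition is split
  off before the rest is phrased by \<open>N\<close> alone.\<close>

lemma continuous_map_nmetric_iff:
  "continuous_map S (mtopology_of (nmetric N A)) f \<longleftrightarrow>
     f \<in> topspace S \<rightarrow> A \<and>
     (\<forall>x\<in>topspace S. \<forall>\<epsilon>>0. \<exists>U. openin S U \<and> x \<in> U \<and> (\<forall>y\<in>U. N (f x - f y) < \<epsilon>))"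
proof -
  interpret M: Metric_space A "\<lambda>x y. N (x - y)"
    by (rule Metric_space_norm)
  have cont: "continuous_map S M.mtopology f \<longleftrightarrow>
      (\<forall>x\<in>topspace S. \<forall>\<epsilon>>0. \<exists>U. openin S U \<and> x \<in> U \<and> (\<forall>y\<in>U. f y \<in> M.mball (f x) \<epsilon>))"
    by (rule M.continuous_map_to_metric)
  have mem: "f \<in> topspace S \<rightarrow> A" if "continuous_map S M.mtopology f"
    using continuous_map_funspace[OF that] by simp
  have ball: "(\<forall>y\<in>U. f y \<in> M.mball (f x) \<epsilon>) \<longleftrightarrow> (\<forall>y\<in>U. N (f x - f y) < \<epsilon>)"
    if "f \<in> topspace S \<rightarrow> A" "openin S U" "x \<in> U" for U x \<epsilon>
    using that openin_subset[OF that(2)] by (auto simp: M.in_mball)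
  show ?thesis
    unfolding mtopology_of_def mspace_nmetric mdist_nmetric
  proof
    assume "continuous_map S M.mtopology f"
    then show "f \<in> topspace S \<rightarrow> A \<and>
        (\<forall>x\<in>topspace S. \<forall>\<epsilon>>0. \<exists>U. openin S U \<and> x \<in> U \<and> (\<forall>y\<in>U. N (f x - f y) < \<epsilon>))"
      using mem ball cont by meson
  next
    assume "f \<in> topspace S \<rightarrow> A \<and>
        (\<forall>x\<in>topspace S. \<forall>\<epsilon>>0. \<exists>U. openin S U \<and> x \<in> U \<and> (\<forall>y\<in>U. N (f x - f y) < \<epsilon>))"
    then show "continuous_map S M.mtopology f"
      unfolding cont using ball by meson
  qed
qed

text \<open>Comparison with the single term \<open>S k\<close> is enough: the ultrametric inequality
  bounds any two later terms by the same \<epsilon>.\<close>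

lemma Cauchy_convergent:
  fixes S :: "nat \<Rightarrow> 'a"
  assumes "\<And>\<epsilon>. 0 < \<epsilon> \<Longrightarrow> \<exists>k. \<forall>m\<ge>k. N (S m - S k) < \<epsilon>"
  shows "\<exists>L. \<forall>\<epsilon>>0. \<exists>k. \<forall>n\<ge>k. N (S n - L) < \<epsilon>"
proof -
  interpret M: Metric_space UNIV "\<lambda>x y. N (x - y)"
    by (rule Metric_space_norm)
  have "M.MCauchy S"
    unfolding M.MCauchy_def
  proof (intro conjI allI impI)
    fix \<epsilon> :: real assume "0 < \<epsilon>"
    then obtain k where "\<forall>m\<ge>k. N (S m - S k) < \<epsilon>"
      using assms by blast
    then show "\<exists>k. \<forall>m n. k \<le> m \<longrightarrow> k \<le> n \<longrightarrow> N (S m - S n) < \<epsilon>"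
      by (metis norm_diff_triangle_less norm_minus_commute)
  qed auto
  moreover have "M.mcomplete"
    using complete by (simp add: mcomplete_of_def)
  ultimately obtain L where "limitin M.mtopology S L sequentially"
    unfolding M.mcomplete_def by blast
  then show ?thesis
    unfolding M.limit_metric_sequentially by auto
qed

lemma limit_unique:
  fixes S :: "nat \<Rightarrow> 'a"
  assumes "\<And>\<epsilon>. 0 < \<epsilon> \<Longrightarrow> \<exists>k. \<forall>n\<ge>k. N (S n - L) < \<epsilon>"
    and "\<And>\<epsilon>. 0 < \<epsilon> \<Longrightarrow> \<exists>k. \<forall>n\<ge>k. N (S n - L') < \<epsilon>"
  shows "L = L'"
proof (rule ccontr)
  assume "L \<noteq> L'"
  then have "0 < N (L - L')"
    by (simp add: norm_pos_iff)
  then obtain k k' where "\<forall>n\<ge>k. N (S n - L) < N (L - L')" "\<forall>n\<ge>k'. N (S n - L') < N (L - L')"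
    using assms by meson
  then have "N (S (max k k') - L) < N (L - L')" "N (S (max k k') - L') < N (L - L')"
    by (meson max.cobounded1 max.cobounded2)+
  then have "N (L - L') < N (L - L')"
    by (metis norm_diff_triangle_less norm_minus_commute)
  then show False by simp
qed

end

section \<open>Measures attached to elements of the Iwasawa algebra\<close>

locale padic_profinite = padic_complex_field p N + profinite_truncations G T trunc
  for p :: nat and N :: "'a::field_char_0 \<Rightarrow> real"
    and G :: "('g, 'b) monoid_scheme" (structure) and T :: "'g topology"
    and trunc :: "nat \<Rightarrow> 'g \<Rightarrow> 'g"
begin

text \<open>Uniform continuity along the finite quotients. Compactness makes this the same as
  continuity, as \<open>mspace_continuous_functions\<close> shows.\<close>

definition cts :: "'a set \<Rightarrow> ('g \<Rightarrow> 'a) set" where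
  "cts A = {\<phi> \<in> carrier G \<rightarrow>\<^sub>E A. \<forall>\<epsilon>>0. \<exists>k. \<forall>x\<in>carrier G. \<forall>y\<in>carrier G.
     trunc k x = trunc k y \<longrightarrow> N (\<phi> x - \<phi> y) < \<epsilon>}"

lemma cts_closed: "\<phi> \<in> cts A \<Longrightarrow> x \<in> carrier G \<Longrightarrow> \<phi> x \<in> A"
  by (auto simp: cts_def)

text \<open>Each point z has a fibre of some depth \<open>k z\<close> on which \<phi> is within
  \<epsilon> of its value at z. Finitely many such fibres cover G, and the largest depth works
  everywhere; comparing through z costs no factor 2.\<close>

lemma continuous_imp_uniformly_continuous:
  assumes \<phi>: "continuous_map T (mtopology_of (nmetric N A)) \<phi>" and "0 < \<epsilon>"
  shows "\<exists>k. \<forall>x\<in>carrier G. \<forall>y\<in>carrier G. trunc k x = trunc k y \<longrightarrow> N (\<phi> x - \<phi> y) < \<epsilon>"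
proof -
  have "\<exists>k. \<forall>y\<in>carrier G. trunc k y = trunc k x \<longrightarrow> N (\<phi> x - \<phi> y) < \<epsilon>" if x: "x \<in> carrier G" for x
  proof -
    obtain U where U: "openin T U" "x \<in> U" "\<forall>y\<in>U. N (\<phi> x - \<phi> y) < \<epsilon>"
      using \<phi> x \<open>0 < \<epsilon>\<close> unfolding continuous_map_nmetric_iff topspace_eq by blast
    then show ?thesis
      using fiber_basis[OF U(1,2)] by blast
  qed
  then obtain k where
    k: "\<And>x y. x \<in> carrier G \<Longrightarrow> y \<in> carrier G \<Longrightarrow> trunc (k x) y = trunc (k x) x \<Longrightarrow> N (\<phi> x - \<phi> y) < \<epsilon>"
    by metis
  define F where "F x = {y \<in> carrier G. trunc (k x) y = trunc (k x) x}" for x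
  have "compactin T (carrier G)"
    using compact topspace_eq by (simp add: compact_space_def)
  moreover have "\<forall>U\<in>F ` carrier G. openin T U"
    using open_fiber by (auto simp: F_def)
  moreover have "carrier G \<subseteq> \<Union>(F ` carrier G)"
    by (auto simp: F_def)
  ultimately obtain \<F> where "finite \<F>" "\<F> \<subseteq> F ` carrier G" "carrier G \<subseteq> \<Union>\<F>"
    unfolding compactin_def by meson
  then obtain Z where Z: "finite Z" "Z \<subseteq> carrier G" "carrier G \<subseteq> \<Union>(F ` Z)"
    by (metis finite_subset_image)
  define K where "K = Max (k ` Z)"
  have "N (\<phi> x - \<phi> y) < \<epsilon>" if xy: "x \<in> carrier G" "y \<in> carrier G" "trunc K x = trunc K y" for x y
  proof -
    obtain z where z: "z \<in> Z" "x \<in> F z"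
      using Z(3) xy(1) by blast
    have "k z \<le> K"
      using Z(1) z(1) by (simp add: K_def)
    then have "trunc (k z) x = trunc (k z) y"
      using trunc_eq_mono[OF xy(3)] xy by blast
    then have "N (\<phi> z - \<phi> x) < \<epsilon>" "N (\<phi> z - \<phi> y) < \<epsilon>"
      using k[of z] z xy Z(2) by (auto simp: F_def)
    then show ?thesis
      by (metis norm_diff_triangle_less norm_minus_commute)
  qed
  then show ?thesis by blast
qed

lemma mspace_continuous_functions: "mspace (continuous_functions N T A) = cts A"
proof -
  have compact: "compactin T (topspace T)"
    using compact by (simp add: compact_space_def)
  have "continuous_map T (mtopology_of (nmetric N A)) \<phi>" if \<phi>: "\<phi> \<in> cts A" for \<phi>
    unfolding continuous_map_nmetric_iff topspace_eq
  proof (intro conjI ballI allI impI)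
    show "\<phi> \<in> carrier G \<rightarrow> A"
      using \<phi> by (auto simp: cts_def)
    fix x and \<epsilon> :: real assume x: "x \<in> carrier G" and "0 < \<epsilon>"
    then obtain k where "\<forall>x\<in>carrier G. \<forall>y\<in>carrier G. trunc k x = trunc k y \<longrightarrow> N (\<phi> x - \<phi> y) < \<epsilon>"
      using \<phi> unfolding cts_def by blast
    then show "\<exists>U. openin T U \<and> x \<in> U \<and> (\<forall>y\<in>U. N (\<phi> x - \<phi> y) < \<epsilon>)"
      using open_fiber[OF x, of k] x by (intro exI[of _ "{y \<in> carrier G. trunc k y = trunc k x}"]) auto
  qed
  moreover have "\<phi> \<in> cts A" if "continuous_map T (mtopology_of (nmetric N A)) \<phi>"
      "\<phi> \<in> extensional (carrier G)" "\<forall>x\<in>carrier G. \<phi> x \<in> A" for \<phi>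
    using that continuous_imp_uniformly_continuous[OF that(1)] by (auto simp: cts_def PiE_def)
  moreover have "\<phi> \<in> extensional (carrier G)" "\<forall>x\<in>carrier G. \<phi> x \<in> A" if "\<phi> \<in> cts A" for \<phi>
    using that by (auto simp: cts_def PiE_def)
  ultimately show ?thesis
    unfolding compactin_mspace_cfunspace[OF compact] topspace_eq mspace_nmetric by blast
qed

lemma cts_compose_trunc:
  assumes "\<phi> \<in> cts A"
  shows "(\<lambda>x\<in>carrier G. \<phi> (trunc k x)) \<in> cts A"
  unfolding cts_def
proof (intro CollectI conjI allI impI)
  show "(\<lambda>x\<in>carrier G. \<phi> (trunc k x)) \<in> carrier G \<rightarrow>\<^sub>E A"
    using cts_closed[OF assms] by auto
  fix \<epsilon> :: real assume "0 < \<epsilon>"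
  then show "\<exists>l. \<forall>x\<in>carrier G. \<forall>y\<in>carrier G. trunc l x = trunc l y \<longrightarrow>
      N ((\<lambda>x\<in>carrier G. \<phi> (trunc k x)) x - (\<lambda>x\<in>carrier G. \<phi> (trunc k x)) y) < \<epsilon>"
    by (intro exI[of _ k]) simp
qed

lemma locally_constant_in_cts:
  assumes "\<phi> \<in> carrier G \<rightarrow>\<^sub>E A" "\<And>x. x \<in> carrier G \<Longrightarrow> \<phi> (trunc k x) = \<phi> x"
  shows "\<phi> \<in> cts A"
proof -
  have "\<phi> x = \<phi> y" if "x \<in> carrier G" "y \<in> carrier G" "trunc k x = trunc k y" for x y
    using assms(2)[OF that(1)] assms(2)[OF that(2)] that(3) by simp
  then have "N (\<phi> x - \<phi> y) < \<epsilon>"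
    if "0 < \<epsilon>" "x \<in> carrier G" "y \<in> carrier G" "trunc k x = trunc k y" for x y \<epsilon>
    using that by (metis diff_self norm_zero)
  then show ?thesis
    using assms(1) unfolding cts_def by blast
qed

text \<open>The points x and \<open>trunc l x\<close> agree at every level up to l. This is the
  density of locally constant functions.\<close>

lemma cts_approx:
  assumes "\<phi> \<in> cts A" "0 < \<epsilon>"
  shows "\<exists>k. \<forall>l\<ge>k. \<forall>x\<in>carrier G. N (\<phi> x - \<phi> (trunc l x)) < \<epsilon>"
proof -
  obtain k where k: "\<forall>x\<in>carrier G. \<forall>y\<in>carrier G. trunc k x = trunc k y \<longrightarrow> N (\<phi> x - \<phi> y) < \<epsilon>"
    using assms unfolding cts_def by blast
  have "trunc k x = trunc k (trunc l x)" if "x \<in> carrier G" "k \<le> l" for x l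
    using that by (simp add: trunc_trunc)
  then show ?thesis
    using k by (meson trunc_closed)
qed

lemma cts_add:
  assumes "\<phi> \<in> cts (valuation_ring N)" "\<psi> \<in> cts (valuation_ring N)"
  shows "(\<lambda>x\<in>carrier G. \<phi> x + \<psi> x) \<in> cts (valuation_ring N)"
  unfolding cts_def
proof (intro CollectI conjI allI impI)
  show "(\<lambda>x\<in>carrier G. \<phi> x + \<psi> x) \<in> carrier G \<rightarrow>\<^sub>E valuation_ring N"
    using cts_closed[OF assms(1)] cts_closed[OF assms(2)]
    by (auto simp: valuation_ring_def intro!: norm_add_le)
  fix \<epsilon> :: real assume \<epsilon>: "0 < \<epsilon>"
  obtain k where k: "\<forall>x\<in>carrier G. \<forall>y\<in>carrier G. trunc k x = trunc k y \<longrightarrow> N (\<phi> x - \<phi> y) < \<epsilon>"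
    using assms(1) \<epsilon> unfolding cts_def by blast
  obtain l where l: "\<forall>x\<in>carrier G. \<forall>y\<in>carrier G. trunc l x = trunc l y \<longrightarrow> N (\<psi> x - \<psi> y) < \<epsilon>"
    using assms(2) \<epsilon> unfolding cts_def by blast
  have "N ((\<phi> x + \<psi> x) - (\<phi> y + \<psi> y)) < \<epsilon>"
    if xy: "x \<in> carrier G" "y \<in> carrier G" "trunc (max k l) x = trunc (max k l) y" for x y
  proof -
    have "trunc k x = trunc k y" "trunc l x = trunc l y"
      using trunc_eq_mono[OF xy(3)] xy(1,2) by auto
    then have "N (\<phi> x - \<phi> y) < \<epsilon>" "N (\<psi> y - \<psi> x) < \<epsilon>"
      using k l xy by auto
    then show ?thesis
      using norm_diff_less[of "\<phi> x - \<phi> y" \<epsilon> "\<psi> y - \<psi> x"] by (simp add: algebra_simps)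
  qed
  then show "\<exists>k. \<forall>x\<in>carrier G. \<forall>y\<in>carrier G. trunc k x = trunc k y \<longrightarrow>
      N ((\<lambda>x\<in>carrier G. \<phi> x + \<psi> x) x - (\<lambda>x\<in>carrier G. \<phi> x + \<psi> x) y) < \<epsilon>"
    by (intro exI[of _ "max k l"]) simp
qed

lemma cts_scale:
  assumes "a \<in> valuation_ring N" "\<phi> \<in> cts (valuation_ring N)"
  shows "(\<lambda>x\<in>carrier G. a * \<phi> x) \<in> cts (valuation_ring N)"
  unfolding cts_def
proof (intro CollectI conjI allI impI)
  have le: "N (a * z) \<le> N z" for z
    using assms(1) norm_nonneg[of a] norm_nonneg[of z]
    by (simp add: norm_mult valuation_ring_def mult_left_le_one_le)
  show "(\<lambda>x\<in>carrier G. a * \<phi> x) \<in> carrier G \<rightarrow>\<^sub>E valuation_ring N"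
    using cts_closed[OF assms(2)] le by (auto simp: valuation_ring_def intro: order_trans)
  fix \<epsilon> :: real assume \<epsilon>: "0 < \<epsilon>"
  obtain k where k: "\<forall>x\<in>carrier G. \<forall>y\<in>carrier G. trunc k x = trunc k y \<longrightarrow> N (\<phi> x - \<phi> y) < \<epsilon>"
    using assms(2) \<epsilon> unfolding cts_def by blast
  have "N (a * \<phi> x - a * \<phi> y) < \<epsilon>"
    if xy: "x \<in> carrier G" "y \<in> carrier G" "trunc k x = trunc k y" for x y
    using le[of "\<phi> x - \<phi> y"] k xy by (force simp: algebra_simps)
  then show "\<exists>k. \<forall>x\<in>carrier G. \<forall>y\<in>carrier G. trunc k x = trunc k y \<longrightarrow>
      N ((\<lambda>x\<in>carrier G. a * \<phi> x) x - (\<lambda>x\<in>carrier G. a * \<phi> x) y) < \<epsilon>"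
    by (intro exI[of _ k]) simp
qed

text \<open>The distribution relation in terms of representatives. The convolution is handled only
  as a compatible family and is never rebuilt as an element of the Iwasawa algebra.\<close>

definition compatible :: "(nat \<Rightarrow> 'g \<Rightarrow> 'a) \<Rightarrow> bool" where
  "compatible a \<longleftrightarrow>
     (\<forall>k l. \<forall>t\<in>level k. k \<le> l \<longrightarrow> a k t = (\<Sum>s | s \<in> level l \<and> trunc k s = t. a l s))"

lemma compatible_sum:
  assumes "compatible a" "k \<le> l"
  shows "(\<Sum>t\<in>level k. f t * a k t) = (\<Sum>s\<in>level l. f (trunc k s) * a l s)"
proof -
  have "(\<Sum>t\<in>level k. f t * a k t) =
      (\<Sum>t\<in>level k. \<Sum>s | s \<in> level l \<and> trunc k s = t. f (trunc k s) * a l s)"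
  proof (intro sum.cong refl)
    fix t assume "t \<in> level k"
    then have "a k t = (\<Sum>s | s \<in> level l \<and> trunc k s = t. a l s)"
      using assms unfolding compatible_def by blast
    then show "f t * a k t = (\<Sum>s | s \<in> level l \<and> trunc k s = t. f (trunc k s) * a l s)"
      by (simp add: sum_distrib_left)
  qed
  also have "\<dots> = (\<Sum>s\<in>level l. f (trunc k s) * a l s)"
    by (intro sum.group) (auto dest: level_closed)
  finally show ?thesis .
qed

definition riemann_sum :: "('g set \<Rightarrow> 'g set \<Rightarrow> 'a) \<Rightarrow> nat \<Rightarrow> ('g \<Rightarrow> 'a) \<Rightarrow> 'a" where
  "riemann_sum \<nu> k \<phi> = (\<Sum>t\<in>level k. \<phi> t * coset_coeff \<nu> k t)"

text \<open>For \<phi> in \<open>cts (valuation_ring N)\<close> the choice is no choice: the limit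
  exists by \<open>integral_of_limit\<close> and is unique by \<open>limit_unique\<close>.\<close>

definition integral_of :: "('g set \<Rightarrow> 'g set \<Rightarrow> 'a) \<Rightarrow> ('g \<Rightarrow> 'a) \<Rightarrow> 'a" where
  "integral_of \<nu> \<phi> = (SOME L. \<forall>\<epsilon>>0. \<exists>k. \<forall>n\<ge>k. N (riemann_sum \<nu> n \<phi> - L) < \<epsilon>)"

section \<open>Integration against a fixed \<nu> as a limit of Riemann sums\<close>

context
  fixes \<nu>
  assumes \<nu>: "\<nu> \<in> iwasawa_algebra (valuation_ring N) G T"
begin

lemma compatible_coset_coeff: "compatible (coset_coeff \<nu>)"
  using coset_coeff_compat[OF \<nu>] by (simp add: compatible_def)

lemma norm_coset_coeff_le_1: "t \<in> level k \<Longrightarrow> N (coset_coeff \<nu> k t) \<le> 1"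
  using coset_coeff_in[OF \<nu>] by (auto simp: valuation_ring_def)

text \<open>Coefficients have norm at most 1 and the ultrametric inequality ignores the number of
  cosets, so the bound is uniform in k.\<close>

lemma norm_riemann_sum_le:
  assumes "0 \<le> B" "\<And>x. x \<in> level k \<Longrightarrow> N (\<phi> x) \<le> B"
  shows "N (riemann_sum \<nu> k \<phi>) \<le> B"
  unfolding riemann_sum_def
proof (rule norm_sum_le[OF assms(1)])
  fix t assume t: "t \<in> level k"
  then have "N (\<phi> t) * N (coset_coeff \<nu> k t) \<le> B * 1"
    using assms norm_coset_coeff_le_1 norm_nonneg by (intro mult_mono) auto
  then show "N (\<phi> t * coset_coeff \<nu> k t) \<le> B"
    by (simp add: norm_mult)
qed

lemma riemann_sum_diff: "riemann_sum \<nu> k \<phi> - riemann_sum \<nu> k \<psi> = riemann_sum \<nu> k (\<lambda>x. \<phi> x - \<psi> x)"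
  by (simp add: riemann_sum_def sum_subtractf left_diff_distrib)

lemma riemann_sum_refine:
  "k \<le> l \<Longrightarrow> riemann_sum \<nu> k \<phi> = riemann_sum \<nu> l (\<lambda>x. \<phi> (trunc k x))"
  unfolding riemann_sum_def using compatible_sum[OF compatible_coset_coeff] by blast

text \<open>Rewriting the k-th Riemann sum at a finer level m replaces \<phi> by \<phi> composed
  with \<open>trunc k\<close>, so the two sums differ by at most the approximation error of
  \<phi>.\<close>

lemma integral_of_limit:
  assumes "\<phi> \<in> cts (valuation_ring N)" "0 < \<epsilon>"
  shows "\<exists>k. \<forall>n\<ge>k. N (riemann_sum \<nu> n \<phi> - integral_of \<nu> \<phi>) < \<epsilon>"
proof -
  have "\<exists>k. \<forall>m\<ge>k. N (riemann_sum \<nu> m \<phi> - riemann_sum \<nu> k \<phi>) < \<epsilon>" if "0 < \<epsilon>" for \<epsilon>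
  proof -
    \<comment> \<open>The estimate for sums is non-strict; halving makes the final bound
      strict.\<close>
    have "0 < \<epsilon> / 2"
      using that by simp
    then obtain k where k: "\<forall>l\<ge>k. \<forall>x\<in>carrier G. N (\<phi> x - \<phi> (trunc l x)) < \<epsilon> / 2"
      using cts_approx[OF assms(1)] by blast
    have "N (riemann_sum \<nu> m \<phi> - riemann_sum \<nu> k \<phi>) < \<epsilon>" if "k \<le> m" for m
    proof -
      have "N (riemann_sum \<nu> m \<phi> - riemann_sum \<nu> k \<phi>) \<le> \<epsilon> / 2"
        unfolding riemann_sum_refine[OF that] riemann_sum_diff
        using k \<open>0 < \<epsilon>\<close> by (intro norm_riemann_sum_le) (auto simp: level_closed less_imp_le)
      then show ?thesis
        using \<open>0 < \<epsilon>\<close> by linarith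
    qed
    then show ?thesis by blast
  qed
  then have "\<exists>L. \<forall>\<epsilon>>0. \<exists>k. \<forall>n\<ge>k. N (riemann_sum \<nu> n \<phi> - L) < \<epsilon>"
    by (rule Cauchy_convergent)
  from someI_ex[OF this] show ?thesis
    using assms(2) unfolding integral_of_def by blast
qed

lemma integral_of_eqI:
  assumes "\<phi> \<in> cts (valuation_ring N)" "\<And>\<epsilon>. 0 < \<epsilon> \<Longrightarrow> \<exists>k. \<forall>n\<ge>k. N (riemann_sum \<nu> n \<phi> - L) < \<epsilon>"
  shows "integral_of \<nu> \<phi> = L"
  using integral_of_limit[OF assms(1)] assms(2) by (rule limit_unique)

text \<open>The integral is Lipschitz with constant 1 for the sup-norm, because this holds for every
  Riemann sum. It yields continuity of the measure.\<close>

lemma norm_integral_of_diff_le: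
  assumes "\<phi> \<in> cts (valuation_ring N)" "\<psi> \<in> cts (valuation_ring N)" "0 \<le> B"
    and "\<And>x. x \<in> carrier G \<Longrightarrow> N (\<phi> x - \<psi> x) \<le> B"
  shows "N (integral_of \<nu> \<phi> - integral_of \<nu> \<psi>) \<le> B"
proof (rule field_le_epsilon)
  fix \<epsilon> :: real assume \<epsilon>: "0 < \<epsilon>"
  obtain k where k: "\<forall>n\<ge>k. N (riemann_sum \<nu> n \<phi> - integral_of \<nu> \<phi>) < \<epsilon>"
    using integral_of_limit[OF assms(1) \<epsilon>] by blast
  obtain l where l: "\<forall>n\<ge>l. N (riemann_sum \<nu> n \<psi> - integral_of \<nu> \<psi>) < \<epsilon>"
    using integral_of_limit[OF assms(2) \<epsilon>] by blast
  define n where "n = max k l"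
  have 1: "N (integral_of \<nu> \<phi> - riemann_sum \<nu> n \<phi>) \<le> B + \<epsilon>"
    using k assms(3) norm_minus_commute by (smt (verit) n_def max.cobounded1)
  have 2: "N (riemann_sum \<nu> n \<psi> - integral_of \<nu> \<psi>) \<le> B + \<epsilon>"
    using l assms(3) by (smt (verit) n_def max.cobounded2)
  have "N (riemann_sum \<nu> n \<phi> - riemann_sum \<nu> n \<psi>) \<le> B"
    unfolding riemann_sum_diff
    using assms(3,4) by (intro norm_riemann_sum_le) (auto simp: level_closed)
  then have 3: "N (riemann_sum \<nu> n \<phi> - riemann_sum \<nu> n \<psi>) \<le> B + \<epsilon>"
    using \<epsilon> by simp
  show "N (integral_of \<nu> \<phi> - integral_of \<nu> \<psi>) \<le> B + \<epsilon>"
    using norm_diff_triangle_le[OF 1 norm_diff_triangle_le[OF 3 2]] .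
qed

lemma integral_of_closed:
  assumes "\<phi> \<in> cts (valuation_ring N)"
  shows "integral_of \<nu> \<phi> \<in> valuation_ring N"
proof -
  obtain n where n: "N (riemann_sum \<nu> n \<phi> - integral_of \<nu> \<phi>) < 1"
    using integral_of_limit[OF assms, of 1] by auto
  have "N (riemann_sum \<nu> n \<phi>) \<le> 1"
    using cts_closed[OF assms] by (intro norm_riemann_sum_le) (auto simp: valuation_ring_def level_closed)
  then show ?thesis
    using norm_diff_le[of "riemann_sum \<nu> n \<phi>" 1 "riemann_sum \<nu> n \<phi> - integral_of \<nu> \<phi>"] n
    by (simp add: valuation_ring_def)
qed

lemma riemann_sum_restrict: "riemann_sum \<nu> k (restrict \<phi> (carrier G)) = riemann_sum \<nu> k \<phi>"
  unfolding riemann_sum_def by (intro sum.cong) (auto simp: level_closed)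

lemma integral_of_add:
  assumes \<phi>: "\<phi> \<in> cts (valuation_ring N)" and \<psi>: "\<psi> \<in> cts (valuation_ring N)"
  shows "integral_of \<nu> (\<lambda>x\<in>carrier G. \<phi> x + \<psi> x) = integral_of \<nu> \<phi> + integral_of \<nu> \<psi>"
proof (rule integral_of_eqI[OF cts_add[OF \<phi> \<psi>]])
  fix \<epsilon> :: real assume \<epsilon>: "0 < \<epsilon>"
  obtain k where k: "\<forall>n\<ge>k. N (riemann_sum \<nu> n \<phi> - integral_of \<nu> \<phi>) < \<epsilon>"
    using integral_of_limit[OF \<phi> \<epsilon>] by blast
  obtain l where l: "\<forall>n\<ge>l. N (riemann_sum \<nu> n \<psi> - integral_of \<nu> \<psi>) < \<epsilon>"
    using integral_of_limit[OF \<psi> \<epsilon>] by blast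
  have "N (riemann_sum \<nu> n (\<lambda>x\<in>carrier G. \<phi> x + \<psi> x) - (integral_of \<nu> \<phi> + integral_of \<nu> \<psi>)) < \<epsilon>"
    if "max k l \<le> n" for n
  proof -
    have "N (riemann_sum \<nu> n \<phi> - integral_of \<nu> \<phi>) < \<epsilon>" "N (integral_of \<nu> \<psi> - riemann_sum \<nu> n \<psi>) < \<epsilon>"
      using k l that norm_minus_commute by auto
    moreover have "riemann_sum \<nu> n (\<lambda>x\<in>carrier G. \<phi> x + \<psi> x) = riemann_sum \<nu> n \<phi> + riemann_sum \<nu> n \<psi>"
      unfolding riemann_sum_restrict by (simp add: riemann_sum_def sum.distrib distrib_right)
    ultimately show ?thesis
      using norm_diff_less[of "riemann_sum \<nu> n \<phi> - integral_of \<nu> \<phi>" \<epsilon> "integral_of \<nu> \<psi> - riemann_sum \<nu> n \<psi>"]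
      by (simp add: algebra_simps)
  qed
  then show "\<exists>k. \<forall>n\<ge>k. N (riemann_sum \<nu> n (\<lambda>x\<in>carrier G. \<phi> x + \<psi> x) -
      (integral_of \<nu> \<phi> + integral_of \<nu> \<psi>)) < \<epsilon>"
    by blast
qed

lemma integral_of_scale:
  assumes a: "a \<in> valuation_ring N" and \<phi>: "\<phi> \<in> cts (valuation_ring N)"
  shows "integral_of \<nu> (\<lambda>x\<in>carrier G. a * \<phi> x) = a * integral_of \<nu> \<phi>"
proof (rule integral_of_eqI[OF cts_scale[OF a \<phi>]])
  fix \<epsilon> :: real assume \<epsilon>: "0 < \<epsilon>"
  obtain k where k: "\<forall>n\<ge>k. N (riemann_sum \<nu> n \<phi> - integral_of \<nu> \<phi>) < \<epsilon>"
    using integral_of_limit[OF \<phi> \<epsilon>] by blast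
  have "N (riemann_sum \<nu> n (\<lambda>x\<in>carrier G. a * \<phi> x) - a * integral_of \<nu> \<phi>) < \<epsilon>" if "k \<le> n" for n
  proof -
    have "riemann_sum \<nu> n (\<lambda>x\<in>carrier G. a * \<phi> x) = a * riemann_sum \<nu> n \<phi>"
      unfolding riemann_sum_restrict by (simp add: riemann_sum_def sum_distrib_left mult.assoc)
    then have "N (riemann_sum \<nu> n (\<lambda>x\<in>carrier G. a * \<phi> x) - a * integral_of \<nu> \<phi>) =
        N a * N (riemann_sum \<nu> n \<phi> - integral_of \<nu> \<phi>)"
      by (metis norm_mult right_diff_distrib)
    also have "\<dots> \<le> N (riemann_sum \<nu> n \<phi> - integral_of \<nu> \<phi>)"
      using a norm_nonneg by (simp add: valuation_ring_def mult_left_le_one_le)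
    finally show ?thesis
      using k that by fastforce
  qed
  then show "\<exists>k. \<forall>n\<ge>k. N (riemann_sum \<nu> n (\<lambda>x\<in>carrier G. a * \<phi> x) - a * integral_of \<nu> \<phi>) < \<epsilon>"
    by blast
qed

end

end

section \<open>Existence and uniqueness of the measure attached to an element of the Iwasawa
  algebra\<close>

context padic_profinite
begin

lemma indicator_coset_trunc:
  assumes "subgroup K G" "ker l \<subseteq> K" "C \<in> carrier (G Mod K)" "x \<in> carrier G"
  shows "trunc l x \<in> C \<longleftrightarrow> x \<in> C"
proof -
  have "ker l #> trunc l x = ker l #> x"
    using assms(4) by (simp add: ker_rcoset trunc_trunc)
  then show ?thesis
    using rcoset_subset_iff[OF assms(1-3)] assms(4) by (metis trunc_closed)
qed

lemma indicator_coset_in_cts: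
  assumes "subgroup K G" "ker l \<subseteq> K" "C \<in> carrier (G Mod K)"
  shows "(\<lambda>g\<in>carrier G. indicator C g) \<in> cts (valuation_ring N)"
  using indicator_coset_trunc[OF assms]
  by (intro locally_constant_in_cts[where k = l])
     (auto simp: indicator_def valuation_ring_def split: if_splits)

text \<open>The predicate under the definite description in \<open>measure_of_iwasawa\<close>, which
  is meaningful only once this has a unique solution.\<close>

definition represents :: "(('g \<Rightarrow> 'a) \<Rightarrow> 'a) \<Rightarrow> ('g set \<Rightarrow> 'g set \<Rightarrow> 'a) \<Rightarrow> bool" where
  "represents \<mu> \<nu> \<longleftrightarrow> \<mu> \<in> measures N T (valuation_ring N) \<and>
     (\<forall>H\<in>open_subgroups G T. \<forall>C\<in>carrier (G Mod H). \<mu> (\<lambda>g\<in>carrier G. indicator C g) = \<nu> H C)"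

lemma represents_exists:
  assumes \<nu>: "\<nu> \<in> iwasawa_algebra (valuation_ring N) G T"
  shows "represents (\<lambda>\<phi>\<in>cts (valuation_ring N). integral_of \<nu> \<phi>) \<nu>"
  unfolding represents_def
proof (intro conjI ballI)
  let ?O = "valuation_ring N" and ?\<mu> = "\<lambda>\<phi>\<in>cts (valuation_ring N). integral_of \<nu> \<phi>"
  have "Lipschitz_continuous_map (continuous_functions N T ?O) (nmetric N ?O) ?\<mu>"
    unfolding Lipschitz_continuous_map_def
  proof (intro conjI exI[of _ 1] ballI)
    show "?\<mu> \<in> mspace (continuous_functions N T ?O) \<rightarrow> mspace (nmetric N ?O)"
      unfolding mspace_continuous_functions mspace_nmetric using integral_of_closed[OF \<nu>] by auto
    fix \<phi> \<psi>
    assume \<phi>: "\<phi> \<in> mspace (continuous_functions N T ?O)" and \<psi>: "\<psi> \<in> mspace (continuous_functions N T ?O)"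
    have "N (\<phi> x - \<psi> x) \<le> mdist (continuous_functions N T ?O) \<phi> \<psi>" if "x \<in> carrier G" for x
      using mdist_cfunspace_imp_mdist_le[OF \<phi> \<psi> order_refl] that topspace_eq by simp
    then show "mdist (nmetric N ?O) (?\<mu> \<phi>) (?\<mu> \<psi>) \<le> 1 * mdist (continuous_functions N T ?O) \<phi> \<psi>"
      using \<phi> \<psi> norm_integral_of_diff_le[OF \<nu>, of \<phi> \<psi> "mdist (continuous_functions N T ?O) \<phi> \<psi>"]
      unfolding mspace_continuous_functions by simp
  qed
  then have cont: "continuous_map (mtopology_of (continuous_functions N T ?O)) (mtopology_of (nmetric N ?O)) ?\<mu>"
    by (rule Lipschitz_continuous_imp_continuous_map)
  show "?\<mu> \<in> measures N T ?O"
    unfolding measures_def mspace_continuous_functions topspace_eq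
    using cont integral_of_closed[OF \<nu>] integral_of_add[OF \<nu>] integral_of_scale[OF \<nu>] cts_add cts_scale
    by auto
  fix H C assume H: "H \<in> open_subgroups G T" and C: "C \<in> carrier (G Mod H)"
  obtain k where k: "\<And>l. k \<le> l \<Longrightarrow> ker l \<subseteq> H"
    using open_subgroup_contains_ker[OF H] by blast
  have sub: "subgroup H G"
    using H by (simp add: open_subgroups_def)
  have ind: "(\<lambda>g\<in>carrier G. indicator C g) \<in> cts ?O"
    using indicator_coset_in_cts[OF sub k[OF order_refl] C] .
  \<comment> \<open>Once \<open>ker n\<close> lies in H, its cosets do not cross the boundary of C,
    so the Riemann sums are stationary.\<close>
  have "riemann_sum \<nu> n (\<lambda>g\<in>carrier G. indicator C g) = \<nu> H C" if "k \<le> n" for n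
  proof -
    have "riemann_sum \<nu> n (\<lambda>g\<in>carrier G. indicator C g) = (\<Sum>t\<in>level n. if t \<in> C then coset_coeff \<nu> n t else 0)"
      unfolding riemann_sum_def by (intro sum.cong) (auto simp: level_closed)
    also have "\<dots> = (\<Sum>t\<in>level n \<inter> C. coset_coeff \<nu> n t)"
      by (simp add: sum.inter_restrict)
    finally show ?thesis
      using iwasawa_coset_sum[OF \<nu> H k[OF that] C] by (simp add: coset_coeff_def)
  qed
  then have "integral_of \<nu> (\<lambda>g\<in>carrier G. indicator C g) = \<nu> H C"
    by (intro integral_of_eqI[OF \<nu> ind] exI[of _ k]) simp
  then show "?\<mu> (\<lambda>g\<in>carrier G. indicator C g) = \<nu> H C"
    using ind by simp
qed

text \<open>Such a \<phi> is the finite combination of indicators of the cosets of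
  \<open>ker k\<close> with weights \<phi>(t), and linearity gives the value. The induction over
  subsets of \<open>level k\<close> builds the combination term by term.\<close>

lemma represents_locally_constant:
  assumes \<mu>: "represents \<mu> \<nu>" and \<phi>: "\<phi> \<in> carrier G \<rightarrow>\<^sub>E valuation_ring N"
    and const: "\<And>x. x \<in> carrier G \<Longrightarrow> \<phi> (trunc k x) = \<phi> x"
  shows "\<mu> \<phi> = riemann_sum \<nu> k \<phi>"
proof -
  let ?O = "valuation_ring N"
  have add: "\<mu> (\<lambda>g\<in>carrier G. \<phi> g + \<psi> g) = \<mu> \<phi> + \<mu> \<psi>" if "\<phi> \<in> cts ?O" "\<psi> \<in> cts ?O" for \<phi> \<psi>
    using \<mu> that unfolding represents_def measures_def mspace_continuous_functions topspace_eq by blast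
  have scale: "\<mu> (\<lambda>g\<in>carrier G. a * \<phi> g) = a * \<mu> \<phi>" if "a \<in> ?O" "\<phi> \<in> cts ?O" for a \<phi>
    using \<mu> that unfolding represents_def measures_def mspace_continuous_functions topspace_eq by blast
  have zero_cts: "(\<lambda>g\<in>carrier G. 0) \<in> cts ?O"
    by (intro locally_constant_in_cts[where k = 0]) (auto simp: valuation_ring_def)
  have zero: "\<mu> (\<lambda>g\<in>carrier G. 0) = 0"
    using scale[OF _ zero_cts, of 0] by (simp add: valuation_ring_def cong: restrict_cong)
  define \<iota> where "\<iota> t = (\<lambda>g\<in>carrier G. indicator (ker k #> t) g :: 'a)" for t
  have \<iota>: "\<iota> t \<in> cts ?O" if "t \<in> level k" for t
    unfolding \<iota>_def using that by (intro indicator_coset_in_cts[OF subgroup_ker, of k]) (auto simp: rcosets_ker)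
  have \<mu>\<iota>: "\<mu> (\<iota> t) = coset_coeff \<nu> k t" if "t \<in> level k" for t
    using \<mu> that ker_open_subgroup by (simp add: represents_def \<iota>_def coset_coeff_def rcosets_ker)
  have "(\<lambda>g\<in>carrier G. \<Sum>t\<in>F. \<phi> t * \<iota> t g) \<in> cts ?O \<and>
      \<mu> (\<lambda>g\<in>carrier G. \<Sum>t\<in>F. \<phi> t * \<iota> t g) = (\<Sum>t\<in>F. \<phi> t * coset_coeff \<nu> k t)"
    if "finite F" "F \<subseteq> level k" for F
    using that
  proof (induction F)
    case empty
    show ?case using zero zero_cts by (simp only: sum.empty)
  next
    case (insert t F)
    then have t: "t \<in> level k" by simp
    have IH: "(\<lambda>g\<in>carrier G. \<Sum>t\<in>F. \<phi> t * \<iota> t g) \<in> cts ?O"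
        "\<mu> (\<lambda>g\<in>carrier G. \<Sum>t\<in>F. \<phi> t * \<iota> t g) = (\<Sum>t\<in>F. \<phi> t * coset_coeff \<nu> k t)"
      using insert.IH insert.prems by blast+
    have \<phi>t: "\<phi> t \<in> ?O"
      using \<phi> level_closed[OF t] by auto
    \<comment> \<open>The inner restrictions put both summands in the form in which
      \<open>add\<close> and \<open>scale\<close> apply to them.\<close>
    have eq: "(\<lambda>g\<in>carrier G. \<Sum>t\<in>insert t F. \<phi> t * \<iota> t g) =
        (\<lambda>g\<in>carrier G. (\<lambda>g\<in>carrier G. \<phi> t * \<iota> t g) g + (\<lambda>g\<in>carrier G. \<Sum>t\<in>F. \<phi> t * \<iota> t g) g)"
      using insert.hyps by (intro restrict_ext) simp
    show ?case
      unfolding eq add[OF cts_scale[OF \<phi>t \<iota>[OF t]] IH(1)] scale[OF \<phi>t \<iota>[OF t]] \<mu>\<iota>[OF t] IH(2)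
      using cts_add[OF cts_scale[OF \<phi>t \<iota>[OF t]] IH(1)] insert.hyps
      by (simp only: sum.insert simp_thms)
  qed
  from this[OF finite_level order_refl]
  have "\<mu> (\<lambda>g\<in>carrier G. \<Sum>t\<in>level k. \<phi> t * \<iota> t g) = riemann_sum \<nu> k \<phi>"
    by (simp add: riemann_sum_def)
  moreover have "(\<lambda>g\<in>carrier G. \<Sum>t\<in>level k. \<phi> t * \<iota> t g) = \<phi>"
  proof (rule extensionalityI[of _ "carrier G"])
    show "\<phi> \<in> extensional (carrier G)"
      using \<phi> by (simp add: PiE_def)
    fix g assume g: "g \<in> carrier G"
    have "(\<Sum>t\<in>level k. \<phi> t * \<iota> t g) = (\<Sum>t\<in>level k. if t = trunc k g then \<phi> t else 0)"
    proof (intro sum.cong refl)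
      fix t assume "t \<in> level k"
      then have "g \<in> ker k #> t \<longleftrightarrow> t = trunc k g"
        using g by (auto simp: ker_rcoset level_closed trunc_level)
      then show "\<phi> t * \<iota> t g = (if t = trunc k g then \<phi> t else 0)"
        using g by (auto simp: \<iota>_def indicator_def)
    qed
    also have "\<dots> = \<phi> g"
      using g const by simp
    finally show "(\<lambda>g\<in>carrier G. \<Sum>t\<in>level k. \<phi> t * \<iota> t g) g = \<phi> g"
      using g by simp
  qed simp
  ultimately show ?thesis by simp
qed

lemma represents_continuous:
  assumes \<mu>: "represents \<mu> \<nu>" and \<phi>: "\<phi> \<in> cts (valuation_ring N)" and "0 < \<epsilon>"
  shows "\<exists>k. \<forall>l\<ge>k. N (\<mu> \<phi> - \<mu> (\<lambda>x\<in>carrier G. \<phi> (trunc l x))) < \<epsilon>"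
proof -
  let ?O = "valuation_ring N"
  let ?m = "continuous_functions N T ?O"
  interpret F: Metric_space "mspace ?m" "mdist ?m"
    by (rule Metric_space_mspace_mdist)
  have "continuous_map (mtopology_of ?m) (mtopology_of (nmetric N ?O)) \<mu>"
    using \<mu> unfolding represents_def measures_def by blast
  then obtain U where U: "openin (mtopology_of ?m) U" "\<phi> \<in> U" "\<forall>\<psi>\<in>U. N (\<mu> \<phi> - \<mu> \<psi>) < \<epsilon>"
    using \<phi> \<open>0 < \<epsilon>\<close> unfolding continuous_map_nmetric_iff topspace_mtopology_of mspace_continuous_functions
    by blast
  then obtain r where r: "0 < r" "F.mball \<phi> r \<subseteq> U"
    unfolding mtopology_of_def F.openin_mtopology by blast
  \<comment> \<open>A pointwise bound gives only a non-strict bound on the sup distance; half the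
    radius stays inside the open ball.\<close>
  have "0 < r / 2"
    using r by simp
  then obtain k where k: "\<forall>l\<ge>k. \<forall>x\<in>carrier G. N (\<phi> x - \<phi> (trunc l x)) < r / 2"
    using cts_approx[OF \<phi>] by blast
  have "(\<lambda>x\<in>carrier G. \<phi> (trunc l x)) \<in> F.mball \<phi> r" if "k \<le> l" for l
  proof -
    have "mdist ?m \<phi> (\<lambda>x\<in>carrier G. \<phi> (trunc l x)) \<le> r / 2"
    proof (rule mdist_cfunspace_le)
      fix x assume "x \<in> topspace T"
      then have "x \<in> carrier G"
        by (simp add: topspace_eq)
      then show "mdist (nmetric N ?O) (\<phi> x) ((\<lambda>x\<in>carrier G. \<phi> (trunc l x)) x) \<le> r / 2"
        using k that by (simp add: less_imp_le)
    qed (use r in simp)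
    moreover have "\<phi> \<in> mspace ?m" "(\<lambda>x\<in>carrier G. \<phi> (trunc l x)) \<in> mspace ?m"
      using \<phi> cts_compose_trunc[OF \<phi>] unfolding mspace_continuous_functions by blast+
    ultimately show ?thesis
      using r(1) unfolding F.in_mball by linarith
  qed
  then show ?thesis
    using U(3) r(2) by blast
qed

text \<open>Both functionals agree on the truncations of \<phi>. Taking as error tolerance the
  distance between their values at \<phi>, the ultrametric inequality makes that distance smaller
  than itself.\<close>

lemma represents_unique:
  assumes \<mu>: "represents \<mu> \<nu>" and \<mu>': "represents \<mu>' \<nu>"
  shows "\<mu> = \<mu>'"
proof (rule extensionalityI[of _ "cts (valuation_ring N)"])
  show "\<mu> \<in> extensional (cts (valuation_ring N))" "\<mu>' \<in> extensional (cts (valuation_ring N))"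
    using \<mu> \<mu>' unfolding represents_def measures_def mspace_continuous_functions by (auto simp: PiE_def)
  fix \<phi> assume \<phi>: "\<phi> \<in> cts (valuation_ring N)"
  show "\<mu> \<phi> = \<mu>' \<phi>"
  proof (rule ccontr)
    assume "\<mu> \<phi> \<noteq> \<mu>' \<phi>"
    then have "0 < N (\<mu> \<phi> - \<mu>' \<phi>)"
      by (simp add: norm_pos_iff)
    then obtain k k' where
      k: "\<forall>l\<ge>k. N (\<mu> \<phi> - \<mu> (\<lambda>x\<in>carrier G. \<phi> (trunc l x))) < N (\<mu> \<phi> - \<mu>' \<phi>)"
         "\<forall>l\<ge>k'. N (\<mu>' \<phi> - \<mu>' (\<lambda>x\<in>carrier G. \<phi> (trunc l x))) < N (\<mu> \<phi> - \<mu>' \<phi>)"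
      using represents_continuous[OF \<mu> \<phi>] represents_continuous[OF \<mu>' \<phi>] by meson
    define l where "l = max k k'"
    define \<psi> where "\<psi> = (\<lambda>x\<in>carrier G. \<phi> (trunc l x))"
    have \<psi>: "\<psi> \<in> carrier G \<rightarrow>\<^sub>E valuation_ring N" "\<And>x. x \<in> carrier G \<Longrightarrow> \<psi> (trunc l x) = \<psi> x"
      using cts_closed[OF \<phi>] by (auto simp: \<psi>_def trunc_trunc)
    have "\<mu> \<psi> = \<mu>' \<psi>"
      using represents_locally_constant[OF \<mu> \<psi>] represents_locally_constant[OF \<mu>' \<psi>] by simp
    moreover have "N (\<mu> \<phi> - \<mu> \<psi>) < N (\<mu> \<phi> - \<mu>' \<phi>)" "N (\<mu>' \<phi> - \<mu>' \<psi>) < N (\<mu> \<phi> - \<mu>' \<phi>)"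
      using k by (auto simp: \<psi>_def l_def)
    ultimately have "N (\<mu> \<phi> - \<mu>' \<phi>) < N (\<mu> \<phi> - \<mu>' \<phi>)"
      by (metis norm_diff_triangle_less norm_minus_commute)
    then show False by simp
  qed
qed

text \<open>The bridge from the abstract measure to finite sums; characters will be evaluated only
  through it.\<close>

lemma measure_of_iwasawa_locally_constant:
  assumes "\<nu> \<in> iwasawa_algebra (valuation_ring N) G T" "\<phi> \<in> carrier G \<rightarrow>\<^sub>E valuation_ring N"
    and "\<And>x. x \<in> carrier G \<Longrightarrow> \<phi> (trunc k x) = \<phi> x"
  shows "measure_of_iwasawa N G T \<nu> \<phi> = riemann_sum \<nu> k \<phi>"
proof -
  have "\<exists>!\<mu>. represents \<mu> \<nu>"
    using represents_exists[OF assms(1)] represents_unique by blast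
  then have "represents (THE \<mu>. represents \<mu> \<nu>) \<nu>"
    by (rule theI')
  then show ?thesis
    using represents_locally_constant assms(2,3)
    unfolding measure_of_iwasawa_def represents_def[abs_def] by blast
qed

end

section \<open>Characters\<close>

locale padic_torsion = padic_profinite p N G T trunc
  for p :: nat and N :: "'a::field_char_0 \<Rightarrow> real"
    and G :: "('g, 'b) monoid_scheme" (structure) and T :: "'g topology"
    and trunc :: "nat \<Rightarrow> 'g \<Rightarrow> 'g" +
  fixes e :: nat
  assumes exponent: "x \<in> carrier G \<Longrightarrow> x [^] (p ^ e) = \<one>"
begin

text \<open>An algebraic form of the character group: factoring through a finite quotient stands in
  for continuity, and \<open>carrier_character_group\<close> proves the two equal.\<close>

definition chars :: "('g \<Rightarrow> 'a) set" where
  "chars = {\<xi> \<in> extensional (carrier G).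
     (\<forall>x\<in>carrier G. \<forall>y\<in>carrier G. \<xi> (x \<otimes> y) = \<xi> x * \<xi> y) \<and> \<xi> \<one> = 1 \<and>
     (\<exists>k. \<forall>x\<in>carrier G. \<xi> (trunc k x) = \<xi> x)}"

lemma char_mult: "\<xi> \<in> chars \<Longrightarrow> x \<in> carrier G \<Longrightarrow> y \<in> carrier G \<Longrightarrow> \<xi> (x \<otimes> y) = \<xi> x * \<xi> y"
  by (simp add: chars_def)

lemma char_one: "\<xi> \<in> chars \<Longrightarrow> \<xi> \<one> = 1"
  by (simp add: chars_def)

lemma char_pow: "\<xi> \<in> chars \<Longrightarrow> x \<in> carrier G \<Longrightarrow> \<xi> (x [^] (n::nat)) = \<xi> x ^ n"
  by (induction n) (simp_all add: char_mult char_one)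

lemma char_root_of_unity: "\<xi> \<in> chars \<Longrightarrow> x \<in> carrier G \<Longrightarrow> \<xi> x ^ (p ^ e) = 1"
  using char_pow[of \<xi> x "p ^ e"] exponent[of x] char_one[of \<xi>] by simp

lemma char_inv: "\<xi> \<in> chars \<Longrightarrow> x \<in> carrier G \<Longrightarrow> \<xi> (inv x) * \<xi> x = 1"
  using char_mult[of \<xi> "inv x" x] char_one[of \<xi>] by simp

lemma norm_char: "\<xi> \<in> chars \<Longrightarrow> x \<in> carrier G \<Longrightarrow> N (\<xi> x) = 1"
  using norm_root_of_unity[OF char_root_of_unity] p_gt_1 by simp

lemma char_finprod:
  assumes "\<xi> \<in> chars" "finite A" "f \<in> A \<rightarrow> carrier G"
  shows "\<xi> (\<Otimes>i\<in>A. f i) = (\<Prod>i\<in>A. \<xi> (f i))"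
  using assms(2,3) by (induction A) (auto simp: char_one[OF assms(1)] char_mult[OF assms(1)])

lemma carrier_valuation_unit_group: "carrier (valuation_unit_group N) = {x. N x = 1}"
proof -
  have "x * inverse x = 1" "inverse x * x = 1" "N (inverse x) = 1" if "N x = 1" for x
  proof -
    have "x \<noteq> 0"
      using that by auto
    then show "x * inverse x = 1" "inverse x * x = 1"
      by simp_all
    then show "N (inverse x) = 1"
      using norm_mult[of x "inverse x"] that by simp
  qed
  moreover have "N x = 1" if "N x \<le> 1" "N y \<le> 1" "x * y = 1" for x y
  proof -
    have "N x * N y = 1"
      using that(3) by (metis norm_mult norm_one)
    then show ?thesis
      using that(1,2) norm_nonneg[of x] norm_nonneg[of y] mult_left_le[of "N y" "N x"] by simp
  qed
  ultimately show ?thesis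
    unfolding units_of_def Units_def ring_of_type_algebra_def valuation_ring_def
    by (auto; metis order_refl)
qed

lemma mult_valuation_unit_group: "x \<otimes>\<^bsub>valuation_unit_group N\<^esub> y = x * y"
  by (simp add: units_of_def ring_of_type_algebra_def)

text \<open>Finitely many roots of unity have a positive minimal distance \<delta>; a function with
  values among them that varies by less than \<delta> on fibres is constant there.\<close>

lemma continuous_char_locally_constant:
  assumes "\<xi> \<in> cts {x. x ^ (p ^ e) = 1}"
  shows "\<exists>k. \<forall>x\<in>carrier G. \<xi> (trunc k x) = \<xi> x"
proof -
  define S where "S = {x::'a. x ^ (p ^ e) = 1}"
  have "finite S"
    using finite_roots_of_unity[of "p ^ e"] p_gt_1 by (simp add: S_def)
  then have fin: "finite ((\<lambda>(x, y). N (x - y)) ` (S \<times> S) - {0})"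
    by simp
  obtain \<delta> where \<delta>: "0 < \<delta>" "\<And>x y. x \<in> S \<Longrightarrow> y \<in> S \<Longrightarrow> x \<noteq> y \<Longrightarrow> \<delta> \<le> N (x - y)"
  proof
    \<comment> \<open>Adding 1 keeps the set nonempty when there is only one root and hence no
      positive distance.\<close>
    let ?D = "insert 1 ((\<lambda>(x, y). N (x - y)) ` (S \<times> S) - {0})"
    have "0 < d" if "d \<in> ?D" for d
      using that norm_nonneg by (auto simp: less_le)
    then show "0 < Min ?D"
      using fin by (subst Min_gr_iff) auto
    show "Min ?D \<le> N (x - y)" if "x \<in> S" "y \<in> S" "x \<noteq> y" for x y
      using fin that by (intro Min_le) (auto simp: norm_eq_0_iff)
  qed
  obtain k where k: "\<forall>l\<ge>k. \<forall>x\<in>carrier G. N (\<xi> x - \<xi> (trunc l x)) < \<delta>"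
    using cts_approx[OF assms \<delta>(1)] by blast
  have "\<xi> (trunc k x) = \<xi> x" if x: "x \<in> carrier G" for x
  proof (rule ccontr)
    assume "\<xi> (trunc k x) \<noteq> \<xi> x"
    then have "\<delta> \<le> N (\<xi> x - \<xi> (trunc k x))"
      using cts_closed[OF assms] x by (intro \<delta>(2)) (auto simp: S_def)
    then show False
      using k x by fastforce
  qed
  then show ?thesis by blast
qed

lemma carrier_character_group: "carrier (character_group N G T) = chars"
proof (intro subset_antisym subsetI)
  fix \<xi> assume "\<xi> \<in> carrier (character_group N G T)"
  then have hom: "\<xi> \<in> hom G (valuation_unit_group N)" and cts: "\<xi> \<in> cts {x. N x = 1}"
    unfolding character_group_def mspace_continuous_functions carrier_valuation_unit_group by auto
  have mult: "\<xi> (x \<otimes> y) = \<xi> x * \<xi> y" if "x \<in> carrier G" "y \<in> carrier G" for x y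
    using hom that by (simp add: hom_def mult_valuation_unit_group)
  \<comment> \<open>An idempotent of norm 1 is nonzero, hence equal to 1.\<close>
  have "\<xi> \<one> * \<xi> \<one> = \<xi> \<one>" "N (\<xi> \<one>) = 1"
    using mult[of \<one> \<one>] cts_closed[OF cts, of \<one>] by auto
  then have one: "\<xi> \<one> = 1"
    by auto
  have pow: "\<xi> (x [^] (n::nat)) = \<xi> x ^ n" if "x \<in> carrier G" for x n
    using that by (induction n) (simp_all add: mult one)
  have "\<xi> x ^ (p ^ e) = 1" if "x \<in> carrier G" for x
    using pow[OF that, of "p ^ e"] exponent[OF that] one by simp
  then have "\<xi> \<in> cts {x. x ^ (p ^ e) = 1}"
    using cts unfolding cts_def by blast
  then show "\<xi> \<in> chars"
    using continuous_char_locally_constant[of \<xi>] cts mult one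
    unfolding chars_def cts_def PiE_def by blast
next
  fix \<xi> assume \<xi>: "\<xi> \<in> chars"
  then obtain k where k: "\<And>x. x \<in> carrier G \<Longrightarrow> \<xi> (trunc k x) = \<xi> x"
    unfolding chars_def by blast
  have PiE: "\<xi> \<in> carrier G \<rightarrow>\<^sub>E {x. N x = 1}"
    using \<xi> norm_char[OF \<xi>] by (auto simp: PiE_def chars_def)
  then have "\<xi> \<in> cts {x. N x = 1}"
    using k by (rule locally_constant_in_cts)
  moreover have "\<xi> \<in> hom G (valuation_unit_group N)"
    using PiE char_mult[OF \<xi>]
    by (intro homI) (auto simp: carrier_valuation_unit_group mult_valuation_unit_group)
  ultimately show "\<xi> \<in> carrier (character_group N G T)"
    unfolding character_group_def mspace_continuous_functions carrier_valuation_unit_group by simp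
qed

lemma mult_character_group:
  "\<psi> \<otimes>\<^bsub>character_group N G T\<^esub> \<theta> = (\<lambda>g\<in>carrier G. \<psi> g * \<theta> g)"
  by (simp add: character_group_def)

lemma one_character_group: "\<one>\<^bsub>character_group N G T\<^esub> = (\<lambda>g\<in>carrier G. 1)"
  by (simp add: character_group_def)

lemma chars_mult:
  assumes "\<psi> \<in> chars" "\<theta> \<in> chars"
  shows "(\<lambda>g\<in>carrier G. \<psi> g * \<theta> g) \<in> chars"
proof -
  obtain k l where kl: "\<And>x. x \<in> carrier G \<Longrightarrow> \<psi> (trunc k x) = \<psi> x"
      "\<And>x. x \<in> carrier G \<Longrightarrow> \<theta> (trunc l x) = \<theta> x"
    using assms unfolding chars_def by blast
  have "\<psi> (trunc (max k l) x) = \<psi> x" "\<theta> (trunc (max k l) x) = \<theta> x" if "x \<in> carrier G" for x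
    using kl(1)[of "trunc (max k l) x"] kl(2)[of "trunc (max k l) x"] kl(1)[OF that] kl(2)[OF that] that
    by (simp_all add: trunc_trunc)
  then have "\<exists>m. \<forall>x\<in>carrier G. (\<lambda>g\<in>carrier G. \<psi> g * \<theta> g) (trunc m x) = (\<lambda>g\<in>carrier G. \<psi> g * \<theta> g) x"
    by (intro exI[of _ "max k l"]) simp
  then show ?thesis
    unfolding chars_def using char_mult[OF assms(1)] char_mult[OF assms(2)] char_one[OF assms(1)] char_one[OF assms(2)]
    by (simp add: mult_ac)
qed

lemma chars_one: "(\<lambda>g\<in>carrier G. 1) \<in> chars"
  by (simp add: chars_def)

lemma chars_inv:
  assumes "\<psi> \<in> chars"
  shows "(\<lambda>g\<in>carrier G. \<psi> (inv g)) \<in> chars"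
proof -
  obtain k where k: "\<And>x. x \<in> carrier G \<Longrightarrow> \<psi> (trunc k x) = \<psi> x"
    using assms unfolding chars_def by blast
  have "\<psi> (inv (trunc k x)) = \<psi> (inv x)" if "x \<in> carrier G" for x
    using k[of "inv x"] that by (simp add: trunc_inv)
  then have "\<exists>m. \<forall>x\<in>carrier G. (\<lambda>g\<in>carrier G. \<psi> (inv g)) (trunc m x) = (\<lambda>g\<in>carrier G. \<psi> (inv g)) x"
    by (intro exI[of _ k]) simp
  then show ?thesis
    unfolding chars_def using char_mult[OF assms] char_one[OF assms]
    by (simp add: inv_mult mult.commute)
qed

lemma comm_group_character_group: "comm_group (character_group N G T)"
proof (rule comm_groupI)
  fix \<psi> assume \<psi>: "\<psi> \<in> carrier (character_group N G T)"
  then have "\<psi> \<in> extensional (carrier G)"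
    unfolding carrier_character_group by (simp add: chars_def)
  then show "\<one>\<^bsub>character_group N G T\<^esub> \<otimes>\<^bsub>character_group N G T\<^esub> \<psi> = \<psi>"
    unfolding mult_character_group one_character_group by (intro extensionalityI[of _ "carrier G"]) auto
  show "\<exists>\<theta>\<in>carrier (character_group N G T). \<theta> \<otimes>\<^bsub>character_group N G T\<^esub> \<psi> = \<one>\<^bsub>character_group N G T\<^esub>"
    unfolding mult_character_group one_character_group
    using \<psi> chars_inv[of \<psi>] char_inv[of \<psi>] unfolding carrier_character_group
    by (intro bexI[of _ "\<lambda>g\<in>carrier G. \<psi> (inv g)"] restrict_ext) auto
qed (auto simp: carrier_character_group mult_character_group one_character_group chars_mult chars_one
      intro!: restrict_ext)

sublocale character: comm_group "character_group N G T"
  by (rule comm_group_character_group)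

lemma inv_character_group:
  assumes "\<psi> \<in> chars"
  shows "inv\<^bsub>character_group N G T\<^esub> \<psi> = (\<lambda>g\<in>carrier G. \<psi> (inv g))"
proof (rule character.inv_equality)
  show "(\<lambda>g\<in>carrier G. \<psi> (inv g)) \<otimes>\<^bsub>character_group N G T\<^esub> \<psi> = \<one>\<^bsub>character_group N G T\<^esub>"
    unfolding mult_character_group one_character_group
    using char_inv[OF assms] by (intro restrict_ext) simp
qed (use assms chars_inv in \<open>auto simp: carrier_character_group\<close>)

lemma nat_pow_character_group:
  assumes "\<psi> \<in> chars"
  shows "\<psi> [^]\<^bsub>character_group N G T\<^esub> (n::nat) = (\<lambda>g\<in>carrier G. \<psi> g ^ n)"
proof (induction n)
  case 0
  show ?case by (simp add: one_character_group)
next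
  case (Suc n)
  then show ?case
    by (auto simp: mult_character_group mult.commute intro!: restrict_ext)
qed

text \<open>Every character is killed by \<open>p ^ e\<close>, so all integer powers, negative ones
  included, are among the powers with exponent below \<open>p ^ e\<close>.\<close>

lemma int_pow_character_group:
  assumes "\<psi> \<in> chars"
  shows "\<psi> [^]\<^bsub>character_group N G T\<^esub> (n::int) =
    \<psi> [^]\<^bsub>character_group N G T\<^esub> nat (n mod int (p ^ e))"
proof -
  let ?q = "int (p ^ e)"
  have \<psi>: "\<psi> \<in> carrier (character_group N G T)"
    using assms by (simp add: carrier_character_group)
  have "\<psi> [^]\<^bsub>character_group N G T\<^esub> ?q = \<psi> [^]\<^bsub>character_group N G T\<^esub> (p ^ e)"
    by (rule int_pow_int)
  also have "\<dots> = \<one>\<^bsub>character_group N G T\<^esub>"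
    unfolding nat_pow_character_group[OF assms] one_character_group
    using char_root_of_unity[OF assms] by (intro restrict_ext) simp
  finally have q: "\<psi> [^]\<^bsub>character_group N G T\<^esub> ?q = \<one>\<^bsub>character_group N G T\<^esub>" .
  have "\<psi> [^]\<^bsub>character_group N G T\<^esub> n = \<psi> [^]\<^bsub>character_group N G T\<^esub> (?q * (n div ?q) + n mod ?q)"
    by simp
  also have "\<dots> = (\<psi> [^]\<^bsub>character_group N G T\<^esub> ?q) [^]\<^bsub>character_group N G T\<^esub> (n div ?q)
      \<otimes>\<^bsub>character_group N G T\<^esub> \<psi> [^]\<^bsub>character_group N G T\<^esub> (n mod ?q)"
    using character.int_pow_mult[OF \<psi>] character.int_pow_pow[OF \<psi>] by metis
  also have "\<dots> = \<psi> [^]\<^bsub>character_group N G T\<^esub> (n mod ?q)"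
    unfolding q using \<psi> by simp
  also have "\<dots> = \<psi> [^]\<^bsub>character_group N G T\<^esub> nat (n mod ?q)"
    using p_gt_1 by (subst int_pow_int[symmetric]) simp
  finally show ?thesis .
qed

text \<open>The characters of the finite quotient by \<open>ker k\<close>, inflated to G. The group
  M of the theorem is of this form.\<close>

definition level_chars :: "nat \<Rightarrow> ('g \<Rightarrow> 'a) set" where
  "level_chars k = {\<xi> \<in> chars. \<forall>x\<in>carrier G. \<xi> (trunc k x) = \<xi> x}"

lemma subgroup_level_chars: "subgroup (level_chars k) (character_group N G T)"
proof (rule character.subgroupI)
  show "level_chars k \<noteq> {}"
    using chars_one by (auto simp: level_chars_def)
  show "inv\<^bsub>character_group N G T\<^esub> \<psi> \<in> level_chars k" if "\<psi> \<in> level_chars k" for \<psi>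
  proof -
    have "\<psi> (inv (trunc k x)) = \<psi> (inv x)" if "x \<in> carrier G" for x
      using that \<open>\<psi> \<in> level_chars k\<close> by (simp add: level_chars_def trunc_inv[symmetric])
    then show ?thesis
      using that chars_inv by (simp add: level_chars_def inv_character_group)
  qed
qed (auto simp: level_chars_def carrier_character_group mult_character_group chars_mult)

text \<open>A member is determined by its values on the finite set \<open>level k\<close>, and these
  lie in the finite set of \<open>p ^ e\<close>-th roots of unity.\<close>

lemma finite_level_chars: "finite (level_chars k)"
proof (rule inj_on_finite)
  show "inj_on (\<lambda>\<xi>. restrict \<xi> (level k)) (level_chars k)"
  proof (rule inj_onI)
    fix \<psi> \<theta> assume A: "\<psi> \<in> level_chars k" "\<theta> \<in> level_chars k" "restrict \<psi> (level k) = restrict \<theta> (level k)"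
    show "\<psi> = \<theta>"
    proof (rule extensionalityI[of _ "carrier G"])
      fix x assume x: "x \<in> carrier G"
      then have "\<psi> (trunc k x) = \<theta> (trunc k x)"
        using A(3) by (metis restrict_apply' trunc_in_level)
      then show "\<psi> x = \<theta> x"
        using A(1,2) x by (simp add: level_chars_def)
    qed (use A in \<open>auto simp: level_chars_def chars_def\<close>)
  qed
  show "(\<lambda>\<xi>. restrict \<xi> (level k)) ` level_chars k \<subseteq> level k \<rightarrow>\<^sub>E {x. x ^ (p ^ e) = 1}"
    using char_root_of_unity by (auto simp: level_chars_def level_closed)
  show "finite (level k \<rightarrow>\<^sub>E {x::'a. x ^ (p ^ e) = 1})"
    using finite_roots_of_unity[of "p ^ e"] p_gt_1 by (intro finite_PiE) auto
qed

end

section \<open>Convolution and Fourier inversion\<close>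

context padic_profinite
begin

text \<open>The map from tuples to G along which the product measure is pushed forward to give the
  convolution of the power push-forwards.\<close>

definition power_product :: "nat \<Rightarrow> (nat \<Rightarrow> 'g) \<Rightarrow> 'g" where
  "power_product n x = (\<Otimes>i\<in>{..<n}. x i [^] i)"

text \<open>
  The coefficients, on \<open>level k\<close>, of the convolution product of the push-forwards of \<open>a\<close> along
  \<open>g \<mapsto> g ^ i\<close> for \<open>i < n\<close>.
\<close>

definition power_convolution :: "(nat \<Rightarrow> 'g \<Rightarrow> 'a) \<Rightarrow> nat \<Rightarrow> nat \<Rightarrow> 'g \<Rightarrow> 'a" where
  "power_convolution a n k t =
     (\<Sum>x | x \<in> {..<n} \<rightarrow>\<^sub>E level k \<and> power_product n x = t. \<Prod>i<n. a k (x i))"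

lemma finite_level_tuples [simp]: "finite ({..<n::nat} \<rightarrow>\<^sub>E level k)"
  by (intro finite_PiE) auto

lemma power_product_level: "x \<in> {..<n} \<rightarrow>\<^sub>E level k \<Longrightarrow> power_product n x \<in> level k"
  unfolding power_product_def by (intro level_finprod) (auto intro: level_pow)

lemma trunc_power_product:
  assumes "x \<in> {..<n} \<rightarrow>\<^sub>E level l"
  shows "trunc k (power_product n x) = power_product n (\<lambda>i\<in>{..<n}. trunc k (x i))"
proof -
  have x: "x i \<in> carrier G" if "i < n" for i
    using assms that level_closed by blast
  then have "trunc k (power_product n x) = (\<Otimes>i\<in>{..<n}. trunc k (x i [^] i))"
    unfolding power_product_def by (intro trunc_finprod) auto
  also have "\<dots> = power_product n (\<lambda>i\<in>{..<n}. trunc k (x i))"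
    unfolding power_product_def using x by (intro finprod_cong') (auto simp: trunc_pow)
  finally show ?thesis .
qed

text \<open>Both sides count the tuples at level l whose product reduces to t: once grouped by their
  product, once by their coordinatewise reduction y.\<close>

lemma compatible_power_convolution:
  assumes a: "compatible a"
  shows "compatible (power_convolution a n)"
  unfolding compatible_def
proof (intro allI ballI impI)
  fix k l t assume t: "t \<in> level k" and kl: "k \<le> l"
  let ?P = "power_product n"
  let ?R = "\<lambda>x. \<lambda>i\<in>{..<n}. trunc k (x i)"
  let ?S = "{x. x \<in> {..<n} \<rightarrow>\<^sub>E level l \<and> trunc k (?P x) = t}"
  let ?Y = "{y. y \<in> {..<n} \<rightarrow>\<^sub>E level k \<and> ?P y = t}"
  have fin: "finite ?S" "finite ?Y"
    by (auto intro: finite_subset[OF _ finite_level_tuples])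
  have im: "?R ` ?S \<subseteq> ?Y"
  proof (rule image_subsetI)
    fix x assume x: "x \<in> ?S"
    then have "trunc k (x i) \<in> level k" if "i < n" for i
      using that by (intro trunc_in_level level_closed[of _ l]) auto
    moreover have "?P (?R x) = t"
      using x trunc_power_product[of x n l k] by simp
    ultimately show "?R x \<in> ?Y"
      by simp
  qed
  have "(\<Sum>s | s \<in> level l \<and> trunc k s = t. power_convolution a n l s) =
      (\<Sum>s | s \<in> level l \<and> trunc k s = t. \<Sum>x | x \<in> ?S \<and> ?P x = s. \<Prod>i<n. a l (x i))"
    unfolding power_convolution_def by (intro sum.cong) auto
  also have "\<dots> = (\<Sum>x\<in>?S. \<Prod>i<n. a l (x i))"
    using fin power_product_level by (intro sum.group) auto
  also have "\<dots> = (\<Sum>y\<in>?Y. \<Sum>x | x \<in> ?S \<and> ?R x = y. \<Prod>i<n. a l (x i))"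
    by (rule sum.group[OF fin im, symmetric])
  also have "\<dots> = (\<Sum>y\<in>?Y. \<Prod>i<n. a k (y i))"
  proof (intro sum.cong refl)
    fix y assume y: "y \<in> ?Y"
    \<comment> \<open>The fibre over y is a product of coordinate fibres, so the sum of products
      becomes a product of sums, to which compatibility of a applies factor by factor.\<close>
    have "{x. x \<in> ?S \<and> ?R x = y} = (\<Pi>\<^sub>E i\<in>{..<n}. {s. s \<in> level l \<and> trunc k s = y i})"
    proof (intro equalityI subsetI)
      fix x assume "x \<in> {x. x \<in> ?S \<and> ?R x = y}"
      then show "x \<in> (\<Pi>\<^sub>E i\<in>{..<n}. {s. s \<in> level l \<and> trunc k s = y i})"
        by (auto simp: PiE_iff)
    next
      fix x assume x: "x \<in> (\<Pi>\<^sub>E i\<in>{..<n}. {s. s \<in> level l \<and> trunc k s = y i})"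
      then have 1: "x \<in> {..<n} \<rightarrow>\<^sub>E level l"
        by (auto simp: PiE_iff)
      have 2: "?R x = y"
        using x y by (intro extensionalityI[of _ "{..<n}"]) (auto simp: PiE_iff)
      have "trunc k (?P x) = t"
        using trunc_power_product[OF 1, of k] y unfolding 2 by simp
      then show "x \<in> {x. x \<in> ?S \<and> ?R x = y}"
        using 1 2 by simp
    qed
    then have "(\<Sum>x | x \<in> ?S \<and> ?R x = y. \<Prod>i<n. a l (x i)) =
        (\<Prod>i<n. \<Sum>s | s \<in> level l \<and> trunc k s = y i. a l s)"
      by (simp add: prod_sum_PiE)
    also have "\<dots> = (\<Prod>i<n. a k (y i))"
    proof (intro prod.cong refl)
      fix i assume "i \<in> {..<n}"
      then have "y i \<in> level k"
        using y by auto
      then show "(\<Sum>s | s \<in> level l \<and> trunc k s = y i. a l s) = a k (y i)"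
        using a kl unfolding compatible_def by metis
    qed
    finally show "(\<Sum>x | x \<in> ?S \<and> ?R x = y. \<Prod>i<n. a l (x i)) = (\<Prod>i<n. a k (y i))" .
  qed
  finally show "power_convolution a n k t =
      (\<Sum>s | s \<in> level l \<and> trunc k s = t. power_convolution a n l s)"
    unfolding power_convolution_def by simp
qed

end

section \<open>Fourier analysis on finite levels and the choice of the twist\<close>

context padic_torsion
begin

text \<open>A character sends the product of the powers x_i^i to the product of the \<xi>(x_i)^i, so
  the sum over tuples factors into one sum per exponent.\<close>

lemma char_sum_power_convolution:
  assumes \<xi>: "\<xi> \<in> chars"
  shows "(\<Sum>t\<in>level k. \<xi> t * power_convolution a n k t) = (\<Prod>i<n. \<Sum>s\<in>level k. \<xi> s ^ i * a k s)"
proof -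
  let ?P = "power_product n" and ?S = "{..<n} \<rightarrow>\<^sub>E level k"
  have "(\<Sum>t\<in>level k. \<xi> t * power_convolution a n k t) =
      (\<Sum>t\<in>level k. \<Sum>x | x \<in> ?S \<and> ?P x = t. \<xi> (?P x) * (\<Prod>i<n. a k (x i)))"
    unfolding power_convolution_def sum_distrib_left by (intro sum.cong) auto
  also have "\<dots> = (\<Sum>x\<in>?S. \<xi> (?P x) * (\<Prod>i<n. a k (x i)))"
    using power_product_level by (intro sum.group) auto
  also have "\<dots> = (\<Sum>x\<in>?S. \<Prod>i<n. \<xi> (x i) ^ i * a k (x i))"
  proof (intro sum.cong refl)
    fix x assume "x \<in> ?S"
    then have x: "x i \<in> carrier G" if "i < n" for i
      using that level_closed by blast
    have "\<xi> (?P x) = (\<Prod>i<n. \<xi> (x i [^] i))"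
      unfolding power_product_def using x by (intro char_finprod[OF \<xi>]) auto
    also have "\<dots> = (\<Prod>i<n. \<xi> (x i) ^ i)"
      using x by (intro prod.cong) (auto simp: char_pow[OF \<xi>])
    finally show "\<xi> (?P x) * (\<Prod>i<n. a k (x i)) = (\<Prod>i<n. \<xi> (x i) ^ i * a k (x i))"
      by (simp add: prod.distrib)
  qed
  also have "\<dots> = (\<Prod>i<n. \<Sum>s\<in>level k. \<xi> s ^ i * a k s)"
    by (intro prod_sum_PiE[symmetric]) auto
  finally show ?thesis .
qed

text \<open>Duality for the finite quotients, kept as a condition here because it depends on their
  structure and on the roots of unity available; it is established from coordinates later.\<close>

definition separated :: bool where
  "separated \<longleftrightarrow>
     (\<forall>k. \<forall>t\<in>carrier G. trunc k t \<noteq> \<one> \<longrightarrow> (\<exists>\<xi>\<in>level_chars k. \<xi> t \<noteq> 1))"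

text \<open>If some \<theta> has \<open>\<theta> y \<noteq> 1\<close>, multiplication by \<theta>
  permutes \<open>level_chars k\<close> and multiplies the sum by \<open>\<theta> y\<close>, so the
  sum vanishes.\<close>

lemma level_chars_orthogonality:
  assumes "separated" and y: "y \<in> carrier G"
  shows "(\<Sum>\<xi>\<in>level_chars k. \<xi> y) =
    (if trunc k y = \<one> then of_nat (card (level_chars k)) else 0)"
proof (cases "trunc k y = \<one>")
  case True
  have "\<xi> y = 1" if "\<xi> \<in> level_chars k" for \<xi>
    using that y True char_one[of \<xi>] unfolding level_chars_def by (metis (mono_tags, lifting) mem_Collect_eq)
  then have "(\<Sum>\<xi>\<in>level_chars k. \<xi> y) = (\<Sum>\<xi>\<in>level_chars k. 1)"
    by (intro sum.cong) auto
  then show ?thesis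
    using True by simp
next
  case False
  then obtain \<theta> where \<theta>: "\<theta> \<in> level_chars k" "\<theta> y \<noteq> 1"
    using assms unfolding separated_def by blast
  let ?m = "\<lambda>\<xi>. \<theta> \<otimes>\<^bsub>character_group N G T\<^esub> \<xi>"
  interpret M: subgroup "level_chars k" "character_group N G T"
    by (rule subgroup_level_chars)
  have "inj_on ?m (level_chars k)"
    using \<theta>(1) by (intro inj_onI) (metis M.mem_carrier character.l_cancel)
  moreover have "?m ` level_chars k \<subseteq> level_chars k"
    using \<theta>(1) by auto
  ultimately have im: "?m ` level_chars k = level_chars k"
    using finite_level_chars by (simp add: endo_inj_surj)
  have "(\<Sum>\<xi>\<in>level_chars k. \<xi> y) = (\<Sum>\<xi>\<in>?m ` level_chars k. \<xi> y)"
    by (simp add: im)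
  also have "\<dots> = (\<Sum>\<xi>\<in>level_chars k. \<theta> y * \<xi> y)"
    using \<open>inj_on ?m (level_chars k)\<close> y by (simp add: sum.reindex mult_character_group)
  also have "\<dots> = \<theta> y * (\<Sum>\<xi>\<in>level_chars k. \<xi> y)"
    by (simp add: sum_distrib_left)
  finally show ?thesis
    using \<theta>(2) False by simp
qed

text \<open>The twist is sought at the level k of the maximum, while l may be as fine as \<psi>
  requires; the bound \<open>max\<close> over all levels is what controls the coefficients at level
  l.\<close>

lemma exists_twist_nonzero:
  assumes sep: "separated" and b: "compatible b" and t: "t \<in> level k"
    and nz: "b k t \<noteq> 0" and max: "\<And>l s. s \<in> level l \<Longrightarrow> N (b l s) \<le> N (b k t)"
    and \<psi>: "\<psi> \<in> chars" and "k \<le> l"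
  shows "\<exists>\<xi>\<in>level_chars k. (\<Sum>s\<in>level l. (\<psi> s * \<xi> s) * b l s) \<noteq> 0"
proof (rule ccontr)
  assume "\<not> ?thesis"
  then have zero: "(\<Sum>s\<in>level l. (\<psi> s * \<xi> s) * b l s) = 0" if "\<xi> \<in> level_chars k" for \<xi>
    using that by blast
  have tG: "t \<in> carrier G"
    using t by (rule level_closed)
  let ?c = "of_nat (card (level_chars k)) :: 'a"
  let ?A = "{s. s \<in> level l \<and> trunc k s = t}"
  \<comment> \<open>Weighting by \<open>\<xi> (inv t)\<close> makes orthogonality single out the
    fibre of \<open>trunc k\<close> over t.\<close>
  have "0 = (\<Sum>\<xi>\<in>level_chars k. \<xi> (inv t) * (\<Sum>s\<in>level l. (\<psi> s * \<xi> s) * b l s))"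
    using zero by simp
  also have "\<dots> = (\<Sum>\<xi>\<in>level_chars k. \<Sum>s\<in>level l. \<psi> s * b l s * \<xi> (inv t \<otimes> s))"
    unfolding sum_distrib_left
    using tG by (intro sum.cong refl) (simp add: level_chars_def char_mult level_closed mult_ac)
  also have "\<dots> = (\<Sum>s\<in>level l. \<psi> s * b l s * (\<Sum>\<xi>\<in>level_chars k. \<xi> (inv t \<otimes> s)))"
    by (subst sum.swap) (simp add: sum_distrib_left)
  also have "\<dots> = (\<Sum>s\<in>level l. if trunc k s = t then \<psi> s * b l s * ?c else 0)"
  proof (intro sum.cong refl)
    fix s assume "s \<in> level l"
    then have s: "s \<in> carrier G"
      by (rule level_closed)
    have "trunc k (inv t \<otimes> s) = inv t \<otimes> trunc k s"
      using s tG t by (simp add: trunc_mult trunc_inv trunc_level)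
    also have "\<dots> = \<one> \<longleftrightarrow> trunc k s = t"
      using s tG by (metis inv_closed inv_equality inv_inv l_inv trunc_closed m_comm)
    finally show "\<psi> s * b l s * (\<Sum>\<xi>\<in>level_chars k. \<xi> (inv t \<otimes> s)) =
        (if trunc k s = t then \<psi> s * b l s * ?c else 0)"
      using s tG by (simp add: level_chars_orthogonality[OF sep])
  qed
  also have "\<dots> = (\<Sum>s\<in>?A. \<psi> s * b l s) * ?c"
    by (simp add: sum.inter_filter[symmetric] sum_distrib_right)
  \<comment> \<open>The number of characters is positive, since the trivial one is among them, and
    so it cancels in characteristic 0.\<close>
  finally have "(\<Sum>s\<in>?A. \<psi> s * b l s) = 0"
    using finite_level_chars subgroup.one_closed[OF subgroup_level_chars, of k] by auto
  moreover have "b k t = (\<Sum>s\<in>?A. b l s)"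
    using b t \<open>k \<le> l\<close> unfolding compatible_def by blast
  ultimately have "b k t = (\<Sum>s\<in>?A. b l s) - (\<Sum>s\<in>?A. \<psi> s * b l s)"
    by simp
  also have "\<dots> = (\<Sum>s\<in>?A. (1 - \<psi> s) * b l s)"
    by (simp add: sum_subtractf left_diff_distrib)
  finally have "b k t = (\<Sum>s\<in>?A. (1 - \<psi> s) * b l s)" .
  \<comment> \<open>Each factor \<open>1 - \<psi> s\<close> has norm below 1, which contradicts
    maximality of \<open>b k t\<close> with a strict inequality.\<close>
  moreover have "N (\<Sum>s\<in>?A. (1 - \<psi> s) * b l s) < N (b k t)"
  proof (rule norm_sum_less)
    show "0 < N (b k t)"
      using nz by (simp add: norm_pos_iff)
    fix s assume s: "s \<in> ?A"
    then have "N (1 - \<psi> s) < 1"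
      using norm_root_of_unity_minus_one_less[OF char_root_of_unity[OF \<psi>]]
      by (metis (mono_tags, lifting) level_closed mem_Collect_eq norm_minus_commute)
    moreover have "N (b l s) \<le> N (b k t)"
      using max s by blast
    moreover have "0 < N (b k t)"
      using nz by (simp add: norm_pos_iff)
    ultimately show "N ((1 - \<psi> s) * b l s) < N (b k t)"
      unfolding norm_mult using norm_nonneg[of "1 - \<psi> s"] norm_nonneg[of "b l s"]
      by (smt (verit) mult_left_le_one_le mult_less_cancel_right2 mult_le_cancel_left1)
  qed
  ultimately show False by simp
qed

lemma measure_char:
  assumes "\<nu> \<in> iwasawa_algebra (valuation_ring N) G T" "\<xi> \<in> chars"
    and "\<And>x. x \<in> carrier G \<Longrightarrow> \<xi> (trunc k x) = \<xi> x"
  shows "measure_of_iwasawa N G T \<nu> (\<lambda>x\<in>carrier G. \<xi> x ^ i) =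
    (\<Sum>s\<in>level k. \<xi> s ^ i * coset_coeff \<nu> k s)"
proof -
  have "measure_of_iwasawa N G T \<nu> (\<lambda>x\<in>carrier G. \<xi> x ^ i) = riemann_sum \<nu> k (\<lambda>x\<in>carrier G. \<xi> x ^ i)"
    using norm_char[OF assms(2)]
    by (intro measure_of_iwasawa_locally_constant[OF assms(1)])
       (auto simp: valuation_ring_def norm_power assms(3))
  then show ?thesis
    using riemann_sum_restrict[OF assms(1)] by (simp add: riemann_sum_def)
qed

lemma horizontal_nonvanishing:
  assumes sep: "separated" and R: "complete_discrete_subring p N R"
    and \<nu>R: "\<nu> \<in> iwasawa_algebra R G T"
    and one: "measure_of_iwasawa N G T \<nu> \<one>\<^bsub>character_group N G T\<^esub> \<noteq> 0"
  shows "\<exists>M. subgroup M (character_group N G T) \<and> finite M \<and>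
           (\<forall>\<psi>\<in>carrier (character_group N G T). \<exists>\<psi>\<^sub>0\<in>M. \<forall>n::int.
              measure_of_iwasawa N G T \<nu>
                ((\<psi> \<otimes>\<^bsub>character_group N G T\<^esub> \<psi>\<^sub>0) [^]\<^bsub>character_group N G T\<^esub> n) \<noteq> 0)"
proof -
  have R_sub: "R \<subseteq> valuation_ring N" and R_discrete: "discretely_valued p N R"
    and R_subring: "subring R (ring_of_type_algebra :: 'a ring)"
    using R by (auto simp: complete_discrete_subring_def)
  note R_closed = subring_type_algebraD[OF R_subring]
  have R_sum: "sum f A \<in> R" if "\<And>i. i \<in> A \<Longrightarrow> f i \<in> R" for f :: "'c \<Rightarrow> 'a" and A
    using that by (induction A rule: infinite_finite_induct) (auto simp: R_closed)
  have R_prod: "prod f A \<in> R" if "\<And>i. i \<in> A \<Longrightarrow> f i \<in> R" for f :: "'c \<Rightarrow> 'a" and A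
    using that by (induction A rule: infinite_finite_induct) (auto simp: R_closed)
  have \<nu>: "\<nu> \<in> iwasawa_algebra (valuation_ring N) G T"
    using \<nu>R iwasawa_algebra_mono[OF R_sub] by blast
  define q where "q = p ^ e"
  define a where "a = coset_coeff \<nu>"
  define b where "b = power_convolution a q"
  have b: "compatible b"
    unfolding b_def a_def using compatible_coset_coeff[OF \<nu>] by (rule compatible_power_convolution)
  \<comment> \<open>Convolution uses only sums and products, so its coefficients stay in the
    discretely valued ring R.\<close>
  have b_R: "b k t \<in> R" for k t
    unfolding b_def power_convolution_def a_def
    by (intro R_sum R_prod coset_coeff_in[OF \<nu>R]) auto
  define S where "S = {b k t | k t. t \<in> level k}"
  have "(\<Sum>s\<in>level 0. a 0 s) \<noteq> 0"
    using measure_char[OF \<nu> chars_one, of 0 0] one by (simp add: a_def one_character_group cong: restrict_cong)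
  \<comment> \<open>At the trivial character all q factors equal \<nu>(1). A constant function can
    be integrated at any level, so 0 will do.\<close>
  then have "(\<Sum>t\<in>level 0. (\<lambda>g\<in>carrier G. 1) t * b 0 t) \<noteq> 0"
    unfolding b_def char_sum_power_convolution[OF chars_one] by (simp add: level_closed)
  then obtain t0 where "t0 \<in> level 0" "b 0 t0 \<noteq> 0"
    by (metis (no_types, lifting) mult_zero_right sum.neutral)
  then obtain y where "y \<in> S" "y \<noteq> 0" "\<And>z. z \<in> S \<Longrightarrow> N z \<le> N y"
    using discretely_valued_attains_max[OF R_discrete R_closed(2) R_sub, of S "b 0 t0"] b_R
    unfolding S_def by blast
  then obtain k t where t: "t \<in> level k" "b k t \<noteq> 0"
    and max: "\<And>l s. s \<in> level l \<Longrightarrow> N (b l s) \<le> N (b k t)"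
    unfolding S_def by blast
  \<comment> \<open>The level k is already fixed, so \<open>level_chars k\<close> is independent of
    \<psi>.\<close>
  have "\<exists>\<psi>\<^sub>0\<in>level_chars k. \<forall>n::int. measure_of_iwasawa N G T \<nu>
          ((\<psi> \<otimes>\<^bsub>character_group N G T\<^esub> \<psi>\<^sub>0) [^]\<^bsub>character_group N G T\<^esub> n) \<noteq> 0"
    if \<psi>: "\<psi> \<in> chars" for \<psi>
  proof -
    obtain m where m: "\<And>x. x \<in> carrier G \<Longrightarrow> \<psi> (trunc m x) = \<psi> x"
      using \<psi> unfolding chars_def by blast
    \<comment> \<open>At this level both \<psi> and every twist from \<open>level_chars k\<close>
      are constant on cosets, so the finite sum is an actual value of the measure.\<close>
    define l where "l = max k m"
    obtain \<xi> where \<xi>: "\<xi> \<in> level_chars k" and nz: "(\<Sum>s\<in>level l. (\<psi> s * \<xi> s) * b l s) \<noteq> 0"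
      using exists_twist_nonzero[OF sep b t max \<psi>, of l] by (auto simp: l_def)
    define \<theta> where "\<theta> = (\<lambda>g\<in>carrier G. \<psi> g * \<xi> g)"
    have \<theta>: "\<theta> \<in> chars"
      unfolding \<theta>_def using \<psi> \<xi> by (intro chars_mult) (auto simp: level_chars_def)
    have \<theta>_trunc: "\<theta> (trunc l x) = \<theta> x" if x: "x \<in> carrier G" for x
    proof -
      have "\<psi> (trunc l x) = \<psi> (trunc m (trunc l x))" "\<xi> (trunc l x) = \<xi> (trunc k (trunc l x))"
        using m \<xi> x by (simp_all add: level_chars_def)
      then show ?thesis
        using m \<xi> x by (simp add: \<theta>_def level_chars_def trunc_trunc l_def)
    qed
    have "(\<Sum>s\<in>level l. (\<psi> s * \<xi> s) * b l s) = (\<Sum>s\<in>level l. \<theta> s * b l s)"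
      by (intro sum.cong) (auto simp: \<theta>_def level_closed)
    also have "\<dots> = (\<Prod>i<q. measure_of_iwasawa N G T \<nu> (\<lambda>x\<in>carrier G. \<theta> x ^ i))"
      unfolding b_def char_sum_power_convolution[OF \<theta>] a_def
      by (intro prod.cong refl measure_char[OF \<nu> \<theta> \<theta>_trunc, symmetric])
    finally have "measure_of_iwasawa N G T \<nu> (\<lambda>x\<in>carrier G. \<theta> x ^ i) \<noteq> 0" if "i < q" for i
      using nz that by auto
    \<comment> \<open>Nonvanishing of a product over all residues modulo q therefore covers every
      integer exponent.\<close>
    moreover have "nat (n mod int q) < q" for n
      using p_gt_1 by (simp add: q_def nat_less_iff)
    ultimately have "measure_of_iwasawa N G T \<nu> (\<theta> [^]\<^bsub>character_group N G T\<^esub> (n::int)) \<noteq> 0" for n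
      unfolding int_pow_character_group[OF \<theta>] nat_pow_character_group[OF \<theta>] q_def by blast
    then show ?thesis
      using \<xi> unfolding \<theta>_def mult_character_group by blast
  qed
  then show ?thesis
    using subgroup_level_chars finite_level_chars unfolding carrier_character_group by blast
qed

end

section \<open>Horizontal pro-p groups\<close>

locale horizontal_coordinates =
  padic_complex_field p N + abelian_profinite_group G T
  for p :: nat and N :: "'a::field_char_0 \<Rightarrow> real"
    and G :: "('g, 'b) monoid_scheme" (structure) and T :: "'g topology" +
  fixes m :: "nat \<Rightarrow> nat" and f :: "'g \<Rightarrow> nat \<Rightarrow> int" and e :: nat
  assumes m_le: "m n \<le> e"
    and f_iso: "f \<in> iso G (product_group UNIV (\<lambda>n. integer_mod_group (p ^ m n)))"
    and f_homeo: "homeomorphic_map T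
      (product_topology (\<lambda>n. discrete_topology (carrier (integer_mod_group (p ^ m n)))) UNIV) f"
begin

lemma p_neq_0 [simp]: "p \<noteq> 0"
  using p_gt_1 by simp

lemma coord_range: "x \<in> carrier G \<Longrightarrow> 0 \<le> f x n \<and> f x n < int (p ^ m n)"
proof -
  assume "x \<in> carrier G"
  then have "f x \<in> (\<Pi>\<^sub>E n\<in>UNIV. carrier (integer_mod_group (p ^ m n)))"
    using f_iso by (auto simp: iso_def hom_def)
  then have "f x n \<in> carrier (integer_mod_group (p ^ m n))"
    by auto
  then show ?thesis
    by (simp add: carrier_integer_mod_group)
qed

lemma coord_mult:
  "x \<in> carrier G \<Longrightarrow> y \<in> carrier G \<Longrightarrow> f (x \<otimes> y) n = (f x n + f y n) mod int (p ^ m n)"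
  using f_iso by (simp add: iso_def hom_def)

lemma coord_one: "f \<one> n = 0"
proof -
  have "group (product_group UNIV (\<lambda>n. integer_mod_group (p ^ m n)))"
    by simp
  then have "f \<one> = \<one>\<^bsub>product_group UNIV (\<lambda>n. integer_mod_group (p ^ m n))\<^esub>"
    using f_iso is_group by (intro hom_one) (auto simp: iso_def)
  then show ?thesis
    by simp
qed

lemma coord_pow: "x \<in> carrier G \<Longrightarrow> f (x [^] (j::nat)) n = (int j * f x n) mod int (p ^ m n)"
proof (induction j)
  case (Suc j)
  then have "f (x [^] Suc j) n = ((int j * f x n) mod int (p ^ m n) + f x n) mod int (p ^ m n)"
    by (simp add: coord_mult)
  then show ?case
    by (simp add: mod_simps algebra_simps)
qed (simp add: coord_one)

lemma coord_ext:
  assumes "x \<in> carrier G" "y \<in> carrier G" "\<And>n. f x n = f y n"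
  shows "x = y"
proof -
  have "inj_on f (carrier G)"
    using f_iso by (auto simp: iso_def bij_betw_def)
  then show ?thesis
    using assms by (auto dest: inj_onD)
qed

lemma coord_surj:
  assumes "\<And>n. 0 \<le> u n \<and> u n < int (p ^ m n)"
  obtains x where "x \<in> carrier G" "f x = u"
proof -
  have "u \<in> (\<Pi>\<^sub>E n\<in>UNIV. carrier (integer_mod_group (p ^ m n)))"
    using assms by (auto simp: carrier_integer_mod_group)
  also have "\<dots> = f ` carrier G"
    using f_iso by (auto simp: iso_def bij_betw_def)
  finally show thesis
    using that by blast
qed

text \<open>Coordinates from k on are set to 0. This splits the projection to the first k factors by
  embedding them back into the product.\<close>

definition truncation :: "nat \<Rightarrow> 'g \<Rightarrow> 'g" where
  "truncation k x = inv_into (carrier G) f (\<lambda>n. if n < k then f x n else 0)"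

lemma truncation:
  assumes "x \<in> carrier G"
  shows truncation_closed: "truncation k x \<in> carrier G"
    and coord_truncation: "f (truncation k x) n = (if n < k then f x n else 0)"
proof -
  obtain y where "y \<in> carrier G" "f y = (\<lambda>n. if n < k then f x n else 0)"
  proof (rule coord_surj[of "\<lambda>n. if n < k then f x n else 0"])
    show "0 \<le> (if n < k then f x n else 0) \<and> (if n < k then f x n else 0) < int (p ^ m n)" for n
      using coord_range[OF assms, of n] p_gt_1 by (cases "n < k") auto
  qed
  then have "(\<lambda>n. if n < k then f x n else 0) \<in> f ` carrier G"
    by (metis imageI)
  then show "truncation k x \<in> carrier G" "f (truncation k x) n = (if n < k then f x n else 0)"
    by (simp_all add: truncation_def inv_into_into f_inv_into_f)
qed

lemma truncation_eq_iff:
  assumes "x \<in> carrier G" "y \<in> carrier G"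
  shows "truncation k x = truncation k y \<longleftrightarrow> (\<forall>n<k. f x n = f y n)"
proof
  show "\<forall>n<k. f x n = f y n" if "truncation k x = truncation k y"
    using coord_truncation[OF assms(1), of k] coord_truncation[OF assms(2), of k] that by metis
  show "truncation k x = truncation k y" if "\<forall>n<k. f x n = f y n"
    using that by (simp add: truncation_def cong: if_cong)
qed

lemma finite_range_truncation: "finite (truncation k ` carrier G)"
proof (rule inj_on_finite)
  show "inj_on (\<lambda>x. restrict (f x) {..<k}) (truncation k ` carrier G)"
  proof (rule inj_onI, clarify)
    fix x y assume xy: "x \<in> carrier G" "y \<in> carrier G"
      and eq: "restrict (f (truncation k x)) {..<k} = restrict (f (truncation k y)) {..<k}"
    have "f x n = f y n" if "n < k" for n
      using fun_cong[OF eq, of n] that xy by (simp add: coord_truncation)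
    then show "truncation k x = truncation k y"
      using xy by (simp add: truncation_eq_iff)
  qed
  show "(\<lambda>x. restrict (f x) {..<k}) ` truncation k ` carrier G \<subseteq> (\<Pi>\<^sub>E n\<in>{..<k}. {0..<int (p ^ m n)})"
  proof clarify
    fix x assume "x \<in> carrier G"
    then show "restrict (f (truncation k x)) {..<k} \<in> (\<Pi>\<^sub>E n\<in>{..<k}. {0..<int (p ^ m n)})"
      using coord_range[OF truncation_closed] by auto
  qed
qed (intro finite_PiE; simp)

lemma open_fiber_truncation:
  assumes "x \<in> carrier G"
  shows "openin T {y \<in> carrier G. truncation k y = truncation k x}"
proof -
  have "openin T {y \<in> carrier G. \<forall>n<k. f y n = f x n}"
  proof (induction k)
    case 0
    then show ?case
      using topspace_eq openin_topspace[of T] by simp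
  next
    case (Suc k)
    have "continuous_map T (discrete_topology (carrier (integer_mod_group (p ^ m k)))) (\<lambda>y. f y k)"
      using homeomorphic_imp_continuous_map[OF f_homeo] continuous_map_componentwise_UNIV by metis
    then have "openin T {y \<in> topspace T. f y k \<in> {f x k}}"
      by (rule openin_continuous_map_preimage)
         (use coord_range[OF assms, of k] in \<open>simp add: carrier_integer_mod_group\<close>)
    then have "openin T ({y \<in> carrier G. f y k = f x k} \<inter> {y \<in> carrier G. \<forall>n<k. f y n = f x n})"
      using Suc by (intro openin_Int) (auto simp: topspace_eq)
    also have "{y \<in> carrier G. f y k = f x k} \<inter> {y \<in> carrier G. \<forall>n<k. f y n = f x n} =
        {y \<in> carrier G. \<forall>n<Suc k. f y n = f x n}"
      by (auto simp: less_Suc_eq)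
    finally show ?case .
  qed
  also have "{y \<in> carrier G. \<forall>n<k. f y n = f x n} = {y \<in> carrier G. truncation k y = truncation k x}"
    using assms truncation_eq_iff by blast
  finally show ?thesis .
qed

text \<open>A basic open box constrains only finitely many coordinates; any k beyond all of them
  gives a fibre inside the box.\<close>

lemma fiber_basis_truncation:
  assumes "openin T U" "x \<in> U"
  shows "\<exists>k. {y \<in> carrier G. truncation k y = truncation k x} \<subseteq> U"
proof -
  have U: "U \<subseteq> carrier G"
    using openin_subset[OF assms(1)] topspace_eq by simp
  let ?D = "\<lambda>n. discrete_topology (carrier (integer_mod_group (p ^ m n)))"
  have "openin (product_topology ?D UNIV) (f ` U)"
    using homeomorphic_imp_open_map[OF f_homeo] assms(1) by (simp add: open_map_def)
  then obtain V where V: "finite {n \<in> UNIV. V n \<noteq> topspace (?D n)}" "f x \<in> Pi\<^sub>E UNIV V" "Pi\<^sub>E UNIV V \<subseteq> f ` U"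
    unfolding openin_product_topology_alt using assms(2) by (meson imageI)
  obtain k where k: "\<forall>n\<in>{n \<in> UNIV. V n \<noteq> topspace (?D n)}. n < k"
    using V(1) finite_nat_set_iff_bounded by blast
  have "y \<in> U" if y: "y \<in> carrier G" "truncation k y = truncation k x" for y
  proof -
    have x: "x \<in> carrier G"
      using assms(2) U by blast
    have eq: "f y n = f x n" if "n < k" for n
      using y x that truncation_eq_iff by blast
    have "f y n \<in> V n" for n
    proof (cases "n < k")
      case True
      then show ?thesis
        using V(2) eq by auto
    next
      case False
      then have "V n = carrier (integer_mod_group (p ^ m n))"
        using k by auto
      then show ?thesis
        using coord_range[OF y(1)] by (simp add: carrier_integer_mod_group)
    qed
    then have "f y \<in> f ` U"
      using V(3) by auto
    then obtain z where "z \<in> U" "f y = f z"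
      by blast
    then have "y = z"
      using y(1) U by (intro coord_ext) auto
    then show ?thesis
      using \<open>z \<in> U\<close> by simp
  qed
  then show ?thesis by blast
qed

lemma truncation_hom: "truncation k \<in> hom G G"
proof (rule homI)
  show "truncation k (x \<otimes> y) = truncation k x \<otimes> truncation k y" if "x \<in> carrier G" "y \<in> carrier G" for x y
    using that by (intro coord_ext) (auto simp: truncation_closed coord_truncation coord_mult)
qed (rule truncation_closed)

lemma truncation_truncation:
  "x \<in> carrier G \<Longrightarrow> truncation k (truncation l x) = truncation (min k l) x"
  by (rule coord_ext) (auto simp: truncation_closed coord_truncation)

lemma pow_exponent: "x \<in> carrier G \<Longrightarrow> x [^] (p ^ e) = \<one>"
proof (rule coord_ext)
  fix n assume x: "x \<in> carrier G"
  have "int (p ^ m n) dvd int (p ^ e) * f x n"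
    using le_imp_power_dvd[OF m_le, of "int p" n] by simp
  then show "f (x [^] (p ^ e)) n = f \<one> n"
    using x by (simp add: coord_pow coord_one)
qed auto

sublocale torsion: padic_torsion p N G T truncation e
  by unfold_locales
     (fact topspace_eq compact truncation_hom truncation_truncation finite_range_truncation
        open_fiber_truncation fiber_basis_truncation pow_exponent)+

text \<open>If \<open>truncation k t\<close> is nontrivial, some coordinate n < k of t is nonzero.
  The character sending x to \<omega>^(f x n), with \<omega> of exact order \<open>p ^ m n\<close>,
  detects it.\<close>

lemma separated: "torsion.separated"
  unfolding torsion.separated_def
proof (intro allI ballI impI)
  fix k t assume t: "t \<in> carrier G" "truncation k t \<noteq> \<one>"
  then obtain n where "f (truncation k t) n \<noteq> f \<one> n"
    using coord_ext[OF truncation_closed[OF t(1)], of \<one> k] by auto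
  then have n: "n < k" "f t n \<noteq> 0"
    using t(1) by (auto simp: coord_truncation coord_one split: if_splits)
  obtain \<zeta> :: 'a where \<zeta>: "\<zeta> ^ (p ^ e) = 1" "\<And>j::nat. \<zeta> ^ j = 1 \<Longrightarrow> p ^ e dvd j"
    using exists_primitive_root_of_unity by blast
  define \<omega> where "\<omega> = \<zeta> ^ (p ^ (e - m n))"
  have pe: "p ^ (e - m n) * p ^ m n = p ^ e"
    using m_le by (simp add: power_add[symmetric])
  have \<omega>: "\<omega> ^ (p ^ m n) = 1"
    unfolding \<omega>_def power_mult[symmetric] pe by (rule \<zeta>(1))
  \<comment> \<open>Coordinates of a product are sums reduced modulo \<open>p ^ m n\<close>, so
    multiplicativity of the character needs exponents of \<omega> to matter only modulo that
    number.\<close>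
  have \<omega>_mod: "\<omega> ^ (j mod p ^ m n) = \<omega> ^ j" for j
  proof -
    have "\<omega> ^ j = \<omega> ^ (p ^ m n * (j div p ^ m n) + j mod p ^ m n)"
      by simp
    also have "\<dots> = \<omega> ^ (j mod p ^ m n)"
      unfolding power_add power_mult \<omega> by simp
    finally show ?thesis ..
  qed
  define \<xi> where "\<xi> = (\<lambda>x\<in>carrier G. \<omega> ^ nat (f x n))"
  have mult: "\<xi> (x \<otimes> y) = \<xi> x * \<xi> y" if "x \<in> carrier G" "y \<in> carrier G" for x y
  proof -
    have "nat (f (x \<otimes> y) n) = (nat (f x n) + nat (f y n)) mod p ^ m n"
      using that coord_range[of x n] coord_range[of y n]
      by (simp add: coord_mult nat_mod_distrib nat_add_distrib nat_power_eq)
    then show ?thesis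
      using that by (simp add: \<xi>_def \<omega>_mod power_add)
  qed
  have trunc: "\<xi> (truncation k x) = \<xi> x" if "x \<in> carrier G" for x
    using that n(1) by (simp add: \<xi>_def truncation_closed coord_truncation)
  have "\<xi> \<in> torsion.chars"
    unfolding torsion.chars_def using mult trunc by (auto simp: \<xi>_def coord_one)
  then have "\<xi> \<in> torsion.level_chars k"
    using trunc by (simp add: torsion.level_chars_def)
  moreover have "\<xi> t \<noteq> 1"
  proof
    assume "\<xi> t = 1"
    then have "\<zeta> ^ (p ^ (e - m n) * nat (f t n)) = 1"
      using t(1) by (simp add: \<xi>_def \<omega>_def power_mult)
    then have "p ^ (e - m n) * p ^ m n dvd p ^ (e - m n) * nat (f t n)"
      unfolding pe by (rule \<zeta>(2))
    then have "p ^ m n dvd nat (f t n)"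
      by simp
    moreover have "0 < nat (f t n)" "nat (f t n) < p ^ m n"
      using n(2) coord_range[OF t(1), of n] by linarith+
    ultimately show False
      by (simp add: nat_dvd_not_less)
  qed
  ultimately show "\<exists>\<xi>\<in>torsion.level_chars k. \<xi> t \<noteq> 1"
    by blast
qed

end

text \<open>The element with coordinate 1 at n and 0 elsewhere has order divisible by
  \<open>p ^ m n\<close>, so \<open>m n\<close> is at most the logarithmic exponent.\<close>

lemma exponents_bounded:
  fixes G (structure) and m :: "nat \<Rightarrow> nat"
  assumes p: "1 < p" and G: "group G"
    and f: "f \<in> iso G (product_group UNIV (\<lambda>n. integer_mod_group (p ^ m n)))"
    and finite_exponent: "log_exponent p G < \<infinity>"
  obtains e :: nat where "\<And>n. m n \<le> e"
proof -
  interpret group G by (rule G)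
  let ?P = "product_group UNIV (\<lambda>n. integer_mod_group (p ^ m n))"
  let ?h = "\<lambda>g. if ord g = 0 then \<infinity> else ereal (log (real p) (real (ord g)))"
  have le: "?h g \<le> log_exponent p G" if "g \<in> carrier G" for g
    unfolding log_exponent_def using that by (rule SUP_upper)
  \<comment> \<open>The identity contributes a term to the supremum, which is therefore not that of
    an empty family.\<close>
  have "log_exponent p G \<noteq> - \<infinity>"
    using le[OF one_closed] by auto
  then obtain r where r: "log_exponent p G = ereal r"
    using finite_exponent by (cases "log_exponent p G") auto
  have "real (m n) \<le> r" for n
  proof -
    \<comment> \<open>If \<open>m n = 0\<close> the factor is trivial and 1 is not one of its
      residues, hence the reduction.\<close>
    define u :: "nat \<Rightarrow> int" where "u i = (if i = n then 1 mod int (p ^ m n) else 0)" for i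
    have "u \<in> carrier ?P"
      using p by (auto simp: u_def carrier_integer_mod_group)
    moreover have "f ` carrier G = carrier ?P"
      using f by (simp only: iso_def bij_betw_def mem_Collect_eq)
    ultimately have "u \<in> f ` carrier G"
      by simp
    then obtain x where x: "x \<in> carrier G" "f x = u"
      by (metis imageE)
    have hom: "f (x [^] (j::nat)) n = int j mod int (p ^ m n)" for j
    proof (induction j)
      case 0
      have "f \<one> = \<one>\<^bsub>?P\<^esub>"
        using f G by (intro hom_one) (auto simp: iso_def)
      then show ?case by simp
    next
      case (Suc j)
      have "f (x [^] Suc j) = f (x [^] j) \<otimes>\<^bsub>?P\<^esub> f x"
        using f x(1) by (simp add: iso_def hom_def)
      then show ?case
        using Suc by (simp add: x(2) u_def mod_add_eq add.commute)
    qed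
    \<comment> \<open>An element of infinite order would put \<infinity> into the supremum, which is
      the real number r.\<close>
    have ord: "ord x \<noteq> 0" "log (real p) (real (ord x)) \<le> r"
      using le[OF x(1)] r by (auto split: if_splits)
    have "int (ord x) mod int (p ^ m n) = 0"
      using hom[of "ord x"] hom[of 0] pow_ord_eq_1[OF x(1)] by simp
    then have "p ^ m n dvd ord x"
      by (metis dvd_eq_mod_eq_0 int_dvd_int_iff)
    then have "p ^ m n \<le> ord x"
      using ord(1) by (simp add: dvd_imp_le)
    then have "real p ^ m n \<le> real (ord x)"
      by (metis of_nat_le_iff of_nat_power)
    then have "log (real p) (real p ^ m n) \<le> log (real p) (real (ord x))"
      using p ord(1) by (subst log_le_cancel_iff) auto
    then show ?thesis
      using ord(2) p by simp
  qed
  then have "m n \<le> nat \<lceil>r\<rceil>" for n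
    using order_trans[OF _ real_nat_ceiling_ge, of "real (m n)" r] by simp
  then show thesis
    using that by blast
qed

theorem theorem3p2:
  fixes p :: nat
    and N :: "'a::field_char_0 \<Rightarrow> real"
    and G :: "('g, 'b) monoid_scheme"
    and T :: "'g topology"
    and R :: "'a set"
    and \<nu> :: "'g set \<Rightarrow> 'g set \<Rightarrow> 'a"
  assumes "prime p"
    and "padic_complex_field p N"
    and "horizontal_pro_p p G T"
    and "log_exponent p G < \<infinity>"
    and "complete_discrete_subring p N R"
    and "\<nu> \<in> iwasawa_algebra R G T"
    and "measure_of_iwasawa N G T \<nu> \<one>\<^bsub>character_group N G T\<^esub> \<noteq> 0"
  shows "\<exists>M. subgroup M (character_group N G T) \<and> finite M \<and>
           (\<forall>\<psi>\<in>carrier (character_group N G T). \<exists>\<psi>\<^sub>0\<in>M. \<forall>n::int.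
              measure_of_iwasawa N G T \<nu>
                ((\<psi> \<otimes>\<^bsub>character_group N G T\<^esub> \<psi>\<^sub>0) [^]\<^bsub>character_group N G T\<^esub> n) \<noteq> 0)"
proof -
  interpret padic_complex_field p N
    by (rule assms(2))
  obtain m :: "nat \<Rightarrow> nat" and f where G: "abelian_profinite_group G T"
    and f: "f \<in> iso G (product_group UNIV (\<lambda>n. integer_mod_group (p ^ m n)))"
    and homeo: "homeomorphic_map T
      (product_topology (\<lambda>n. discrete_topology (carrier (integer_mod_group (p ^ m n)))) UNIV) f"
    using assms(3) unfolding horizontal_pro_p_def by (elim exE conjE) (rule that)
  interpret abelian_profinite_group G T
    by (rule G)
  obtain e where "\<And>n. m n \<le> e"
    using exponents_bounded[OF p_gt_1 is_group f assms(4)] by blast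
  then interpret horizontal_coordinates p N G T m f e
    using f homeo by (intro horizontal_coordinates.intro horizontal_coordinates_axioms.intro assms(2) G)
  show ?thesis
    by (rule torsion.horizontal_nonvanishing[OF separated assms(5-7)])
qed

end
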